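(* For every prime power $q$, every fixed integer $t\geq 1$, and every real $\rho\in[0,1]$, \[ \kappa_t^{\mathrm{Lin}}(\rho,q)=\kappa_t(\rho,q)= \begin{cases} 1-H_{q^t}(\rho), & 0\leq\rho<1-q^{-t},\\ 0, & 1-q^{-t}\leq\rho\leq 1. \end{cases} \]
   Context: For an integer $Q\ge 2$ and $x\in[0,1]$, the $Q$-ary entropy function is $H_Q(x):=x\log_Q(Q-1)-x\log_Q x-(1-x)\log_Q(1-x)$, with $0\log_Q 0=0$. Let $q$ be a prime power and $\mathbb F_q$ the field with $q$ elements. $\mathbb F_q^{t\times n}$ denotes the set of $t\times n$ matrices over $\mathbb F_q$. The $t$-weight $\mathrm{wt}^{(t)}(\mathbf v)$ of $\mathbf v\in \mathbb F_q^{t\times n}$ is the number of nonzero columns of $\mathbf v$, and the $t$-distance is $d^{(t)}(\mathbf v,\mathbf u):=\mathrm{wt}^{(t)}(\mathbf v-\mathbf u)$. For a nonempty code $C\subseteq \mathbb F_q^n$, $C^t\subseteq \mathbb F_q^{t\times n}$ is the set of $t\times n$ matrices all of whose rows belong to $C$, and the $t$-th covering radius of $C$ is \[ R_t(C):=\max_{\mathbf u\in \mathbb F_q^{t\times n}}\ \min_{\mathbf c\in C^t} d^{(t)}(\mathbf c,\mathbf u). \] $C\le\mathbb F_q^n$ means that $C$ is an $\mathbb F_q$-linear subspace. For integers $n,t\ge1$ and real $0\le r\le n$, define \[ k_t(n,r,q):=\min\{\log_q|C| : \emptyset\neq C\subseteq \mathbb F_q^n,\ R_t(C)\leq r\},\qquad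 k_t^{\mathrm{Lin}}(n,r,q):=\min\{\dim_{\mathbb F_q}C : C\leq\mathbb F_q^n,\ R_t(C)\leq r\}, \] and for $\rho\in[0,1]$ define \[ \kappa_t(\rho,q):=\liminf_{n\to\infty}\frac{k_t(n,\rho n,q)}{n},\qquad \kappa_t^{\mathrm{Lin}}(\rho,q):=\liminf_{n\to\infty}\frac{k_t^{\mathrm{Lin}}(n,\rho n,q)}{n}. \] *)

theory Defs
  imports
    "HOL-Analysis.Analysis"
    "HOL-Number_Theory.Prime_Powers"
    "Jordan_Normal_Form.VS_Connect"
begin

(* The convention 0 * log 0 = 0 holds automatically, at x = 0 and at x = 1. *)
definition entropy :: "nat \<Rightarrow> real \<Rightarrow> real" where
  "entropy Q x =
     x * log (real Q) (real Q - 1) - x * log (real Q) x - (1 - x) * log (real Q) (1 - x)"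

(* The field F_q is a type 'a of sort {field, finite}, with q = CARD('a). *)

definition t_weight :: "'a::{field,finite} mat \<Rightarrow> nat" where
  "t_weight v = card {j. j < dim_col v \<and> col v j \<noteq> 0\<^sub>v (dim_row v)}"

definition t_dist :: "'a::{field,finite} mat \<Rightarrow> 'a mat \<Rightarrow> nat" where
  "t_dist v u = t_weight (v - u)"

definition code_power :: "nat \<Rightarrow> nat \<Rightarrow> 'a::{field,finite} vec set \<Rightarrow> 'a mat set" where
  "code_power t n C = {c \<in> carrier_mat t n. \<forall>i<t. row c i \<in> C}"

definition covering_radius :: "nat \<Rightarrow> nat \<Rightarrow> 'a::{field,finite} vec set \<Rightarrow> nat" where
  "covering_radius t n C =
     Max ((\<lambda>u. Min ((\<lambda>c. t_dist c u) ` code_power t n C)) ` carrier_mat t n)"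

definition covering_codes :: "nat \<Rightarrow> nat \<Rightarrow> real \<Rightarrow> 'a::{field,finite} vec set set" where
  "covering_codes t n r =
     {C. C \<noteq> {} \<and> C \<subseteq> carrier_vec n \<and> real (covering_radius t n C) \<le> r}"

definition linear_code :: "nat \<Rightarrow> 'a::{field,finite} vec set \<Rightarrow> bool" where
  "linear_code n C \<longleftrightarrow> subspace class_ring C (module_vec TYPE('a) n)"

definition code_dim :: "nat \<Rightarrow> 'a::{field,finite} vec set \<Rightarrow> nat" where
  "code_dim n C = vectorspace.dim class_ring ((module_vec TYPE('a) n)\<lparr>carrier := C\<rparr>)"

definition linear_covering_codes :: "nat \<Rightarrow> nat \<Rightarrow> real \<Rightarrow> 'a::{field,finite} vec set set" where
  "linear_covering_codes t n r = {C. linear_code n C \<and> real (covering_radius t n C) \<le> r}"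

definition k_cov :: "'a::{field,finite} itself \<Rightarrow> nat \<Rightarrow> nat \<Rightarrow> real \<Rightarrow> real" where
  "k_cov F t n r =
     Min ((\<lambda>C. log (real CARD('a)) (real (card C))) `
       (covering_codes t n r :: 'a vec set set))"

definition k_cov_lin :: "'a::{field,finite} itself \<Rightarrow> nat \<Rightarrow> nat \<Rightarrow> real \<Rightarrow> nat" where
  "k_cov_lin F t n r = Min (code_dim n ` (linear_covering_codes t n r :: 'a vec set set))"

definition kappa :: "'a::{field,finite} itself \<Rightarrow> nat \<Rightarrow> real \<Rightarrow> ereal" where
  "kappa F t \<rho> = liminf (\<lambda>n. ereal (k_cov F t n (\<rho> * real n) / real n))"

definition kappa_lin :: "'a::{field,finite} itself \<Rightarrow> nat \<Rightarrow> real \<Rightarrow> ereal" where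
  "kappa_lin F t \<rho> = liminf (\<lambda>n. ereal (real (k_cov_lin F t n (\<rho> * real n)) / real n))"


(* All minima and maxima above range over finite nonempty sets (for r \<ge> 0),
   so they are attained. *)

lemma finite_carrier_mat: "finite (carrier_mat t n :: 'a::finite mat set)"
proof -
  let ?F = "PiE ({..<t} \<times> {..<n}) (\<lambda>_. UNIV :: 'a set)"
  have "carrier_mat t n \<subseteq> (\<lambda>f. mat t n f) ` ?F"
  proof
    fix A :: "'a mat" assume A: "A \<in> carrier_mat t n"
    have "A = mat t n (restrict (\<lambda>ij. A $$ ij) ({..<t} \<times> {..<n}))"
      using A by (intro eq_matI) auto
    thus "A \<in> (\<lambda>f. mat t n f) ` ?F" by (subst image_iff, intro bexI) (auto split: if_splits)
  qed
  moreover have "finite ?F" by (intro finite_PiE) auto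
  ultimately show ?thesis using finite_surj by blast
qed

lemma finite_carrier_vec: "finite (carrier_vec n :: 'a::finite vec set)"
proof -
  let ?F = "PiE {..<n} (\<lambda>_. UNIV :: 'a set)"
  have "carrier_vec n \<subseteq> (\<lambda>f. vec n f) ` ?F"
  proof
    fix v :: "'a vec" assume v: "v \<in> carrier_vec n"
    have "v = vec n (restrict (\<lambda>i. v $ i) {..<n})"
      using v by (intro eq_vecI) auto
    thus "v \<in> (\<lambda>f. vec n f) ` ?F" by (subst image_iff, intro bexI) (auto split: if_splits)
  qed
  moreover have "finite ?F" by (intro finite_PiE) auto
  ultimately show ?thesis using finite_surj by blast
qed

lemma carrier_mat_nonempty: "(carrier_mat t n :: 'a::zero mat set) \<noteq> {}"
  using zero_carrier_mat by blast

lemma finite_code_power: "finite (code_power t n C)"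
  by (rule finite_subset[OF _ finite_carrier_mat[of t n]]) (auto simp: code_power_def)

lemma code_power_nonempty:
  assumes "C \<noteq> {}" "C \<subseteq> carrier_vec n"
  shows "code_power t n C \<noteq> {}"
proof -
  obtain v where v: "v \<in> C" "v \<in> carrier_vec n" using assms by blast
  have "row (mat t n (\<lambda>(i, j). v $ j)) i = v" if "i < t" for i
    using that v by (intro eq_vecI) auto
  hence "mat t n (\<lambda>(i, j). v $ j) \<in> code_power t n C"
    using v by (auto simp: code_power_def)
  thus ?thesis by blast
qed

lemma linear_code_subset: "linear_code n C \<Longrightarrow> C \<subseteq> carrier_vec n"
  by (auto simp: linear_code_def subspace_def LinearCombinations.submodule_def module_vec_def)

lemma linear_code_nonempty: "linear_code n C \<Longrightarrow> C \<noteq> {}"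
  by (auto simp: linear_code_def subspace_def LinearCombinations.submodule_def)

lemma linear_code_carrier: "linear_code n (carrier_vec n)"
  unfolding linear_code_def subspace_def LinearCombinations.submodule_def
  using vec_vs vec_module by (auto simp: module_vec_simps)

lemma covering_radius_carrier: "covering_radius t n (carrier_vec n :: 'a::{field,finite} vec set) = 0"
proof -
  have pow: "code_power t n (carrier_vec n :: 'a vec set) = carrier_mat t n"
    by (auto simp: code_power_def)
  have "Min ((\<lambda>c. t_dist c u) ` carrier_mat t n) = 0"
    if "u \<in> carrier_mat t n" for u :: "'a mat"
  proof -
    have "t_dist u u = 0"
      using that by (auto simp: t_dist_def t_weight_def)
    hence "(0::nat) \<in> (\<lambda>c. t_dist c u) ` carrier_mat t n" using that by force
    thus ?thesis using finite_carrier_mat by (metis Min_le finite_imageI le_zero_eq)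
  qed
  hence "(\<lambda>u::'a mat. Min ((\<lambda>c. t_dist c u) ` carrier_mat t n)) ` carrier_mat t n = {0}"
    using carrier_mat_nonempty by (force simp: image_def)
  thus ?thesis by (simp add: covering_radius_def pow)
qed

lemma finite_covering_codes:
  "finite (covering_codes t n r :: 'a::{field,finite} vec set set)"
  by (rule finite_subset[of _ "Pow (carrier_vec n)"])
    (auto simp: covering_codes_def finite_carrier_vec)

lemma linear_covering_codes_subset: "linear_covering_codes t n r \<subseteq> covering_codes t n r"
  using linear_code_subset linear_code_nonempty
  by (fastforce simp: linear_covering_codes_def covering_codes_def)

lemma finite_linear_covering_codes:
  "finite (linear_covering_codes t n r :: 'a::{field,finite} vec set set)"
  using finite_subset[OF linear_covering_codes_subset finite_covering_codes] .

lemma linear_covering_codes_nonempty: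
  assumes "r \<ge> 0"
  shows "(linear_covering_codes t n r :: 'a::{field,finite} vec set set) \<noteq> {}"
proof -
  have "(carrier_vec n :: 'a vec set) \<in> linear_covering_codes t n r"
    using assms by (simp add: linear_covering_codes_def linear_code_carrier covering_radius_carrier)
  thus ?thesis by blast
qed

lemma covering_codes_nonempty:
  assumes "r \<ge> 0"
  shows "(covering_codes t n r :: 'a::{field,finite} vec set set) \<noteq> {}"
  using linear_covering_codes_nonempty[OF assms] linear_covering_codes_subset by blast

end

theory Submission
  imports Defs "HOL-Library.Function_Algebras" "HOL-Combinatorics.Multiset_Permutations"
    "HOL-Real_Asymp.Real_Asymp"
begin

text \<open>
  Put \<open>Q = q ^ t\<close> and regard a \<open>t \<times> n\<close> matrix as a word of length \<open>n\<close> over the alphabet of its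
  columns. The lower bound is sphere covering: \<open>|C| ^ t\<close> balls, each of size at most
  \<open>Q powr (n H(\<rho>))\<close>, cover \<open>Q ^ n\<close> matrices.

  For the upper bound replace the ball by the set \<open>T\<close> of words in which every nonzero column occurs
  equally often. Let \<open>C\<close> be spanned by \<open>k\<close> uniformly random rows \<open>G\<close>; for a random centre \<open>u\<close> count the
  matrices \<open>A\<close> with \<open>A G + u \<in> T\<close>. In the second moment a pair of matrices with difference \<open>D\<close>
  contributes according to the column space \<open>U\<close> of \<open>D\<close> alone, namely by the collision probability of a
  uniform word of \<open>T\<close> after reduction modulo \<open>U\<close>. The symmetric group acts transitively on \<open>T\<close> and on
  its reductions, so all fibres of a reduction are equally large; this makes
  \<open>log |T / U|\<close> submodular in \<open>U\<close>. As it depends only on \<open>|U|\<close>, it is concave in the codimension \<open>s\<close>,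
  whence \<open>|T / U| \<ge> |T| powr (s / t)\<close>. Hence all proper subspaces \<open>U\<close>
  are negligible as soon as \<open>q ^ (n - k)\<close> is a small constant times \<open>|T| powr (1 / t)\<close>, and
  some \<open>C\<close> covers half of all matrices. Adjoining the \<open>t\<close> rows of a suitable matrix to \<open>C\<close> squares the
  uncovered fraction, so \<open>O(log n)\<close> further rows cover everything.
\<close>

section \<open>Rearrangements of a multiset\<close>

lemma card_eq_sum_fibres:
  assumes "finite A" "finite B" "f ` A \<subseteq> B"
  shows "card A = (\<Sum>y\<in>B. card {x \<in> A. f x = y})"
  using sum.group[OF assms, of "\<lambda>_. 1::nat"] by simp

text \<open>Permuting positions carries the arrangements above \<open>ys\<close> injectively to
  those above any other arrangement of the image multiset. By this symmetry all fibres of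
  \<open>map f\<close> are equally large.\<close>

lemma card_permutations_of_multiset_fibre:
  assumes ys: "ys \<in> permutations_of_multiset (image_mset f M)"
  shows "card {xs \<in> permutations_of_multiset M. map f xs = ys}
           * card (permutations_of_multiset (image_mset f M)) = card (permutations_of_multiset M)"
proof -
  let ?P = "permutations_of_multiset M" and ?R = "permutations_of_multiset (image_mset f M)"
  let ?F = "\<lambda>ys. {xs \<in> ?P. map f xs = ys}"
  \<comment> \<open>An inequality for every pair suffices: exchanging \<open>ys\<close> and
    \<open>zs\<close> turns it into equality.\<close>
  have le: "card (?F ys) \<le> card (?F zs)" if "ys \<in> ?R" "zs \<in> ?R" for ys zs
  proof -
    have "mset zs = mset ys" using that by (auto simp: permutations_of_multiset_def)
    then obtain p where p: "p permutes {..<length ys}" "permute_list p ys = zs"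
      by (rule mset_eq_permutation)
    have len: "length xs = length ys" if "xs \<in> ?F ys" for xs using that by auto
    have "inj_on (permute_list p) (?F ys)"
    proof (rule inj_onI)
      fix xs xs' assume x: "xs \<in> ?F ys" "xs' \<in> ?F ys" and e: "permute_list p xs = permute_list p xs'"
      have l: "length xs = length ys" "length xs' = length ys" using x len by auto
      show "xs = xs'"
      proof (rule nth_equalityI)
        fix i assume i: "i < length xs"
        then obtain j where j: "j < length ys" "p j = i"
          using p(1) l by (metis lessThan_iff permutes_def permutes_in_image)
        have "permute_list p xs ! j = permute_list p xs' ! j" using e by simp
        thus "xs ! i = xs' ! i" using j l p(1) by (simp add: permute_list_nth)
      qed (use l in simp)
    qed
    moreover have "permute_list p ` ?F ys \<subseteq> ?F zs"
    proof
      fix w assume "w \<in> permute_list p ` ?F ys"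
      then obtain xs where x: "xs \<in> ?F ys" "w = permute_list p xs" by auto
      have px: "p permutes {..<length xs}" using p len[OF x(1)] by simp
      have "map f w = permute_list p (map f xs)" unfolding x(2) by (rule permute_list_map[OF px, symmetric])
      hence "map f w = zs" using x p by simp
      moreover have "mset w = mset xs" using px x by simp
      ultimately show "w \<in> ?F zs" using x by (auto simp: permutations_of_multiset_def)
    qed
    ultimately show ?thesis by (intro card_inj_on_le[of "permute_list p"]) auto
  qed
  have "card ?P = (\<Sum>zs\<in>?R. card (?F zs))"
    by (rule card_eq_sum_fibres) (auto simp: permutations_of_multiset_image)
  also have "\<dots> = (\<Sum>zs\<in>?R. card (?F ys))"
    using le ys by (intro sum.cong refl antisym) auto
  finally show ?thesis by simp
qed

text \<open>An arrangement seen through \<open>f\<close> is determined by its images under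
  \<open>f1\<close> and \<open>f2\<close>, and these agree after reduction to \<open>f0\<close>. So
  the arrangements under \<open>f\<close> embed into a fibre product, whose size is known because
  fibres are equally large. This is submodularity of entropy in counting form.\<close>

lemma card_permutations_of_multiset_submodular:
  assumes inj: "\<And>x y. x \<in># M \<Longrightarrow> y \<in># M \<Longrightarrow> f1 x = f1 y \<Longrightarrow> f2 x = f2 y \<Longrightarrow> f x = f y"
    and g1: "\<And>x. x \<in># M \<Longrightarrow> g1 (f1 x) = f0 x" and g2: "\<And>x. x \<in># M \<Longrightarrow> g2 (f2 x) = f0 x"
  shows "card (permutations_of_multiset (image_mset f M)) * card (permutations_of_multiset (image_mset f0 M))
    \<le> card (permutations_of_multiset (image_mset f1 M)) * card (permutations_of_multiset (image_mset f2 M))"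
proof -
  let ?P = "\<lambda>f. permutations_of_multiset (image_mset f M)"
  let ?M = "permutations_of_multiset M"
  have P: "?P h = map h ` ?M" for h by (simp add: permutations_of_multiset_image)
  have set: "set xs \<subseteq> set_mset M" if "xs \<in> ?M" for xs
    using that by (auto simp: permutations_of_multiset_def)
  have m1: "map g1 (map f1 xs) = map f0 xs" and m2: "map g2 (map f2 xs) = map f0 xs" if "xs \<in> ?M" for xs
    using set[OF that] g1 g2 by auto
  have im1: "image_mset g1 (image_mset f1 M) = image_mset f0 M"
    using g1 by (auto simp: multiset.map_comp intro!: image_mset_cong)
  have im2: "image_mset g2 (image_mset f2 M) = image_mset f0 M"
    using g2 by (auto simp: multiset.map_comp intro!: image_mset_cong)
  \<comment> \<open>The fibre product over the \<open>f0\<close> arrangements, with the common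
    arrangement kept as first component.\<close>
  define Z where "Z = (SIGMA w:?P f0. {y \<in> ?P f1. map g1 y = w} \<times> {y \<in> ?P f2. map g2 y = w})"
  have cZ: "card Z * card (?P f0) = card (?P f1) * card (?P f2)"
  proof -
    have ne: "card (?P f0) > 0" by (simp add: card_gt_0_iff)
    have F: "real (card {y \<in> ?P f1. map g1 y = w}) = card (?P f1) / card (?P f0)"
      "real (card {y \<in> ?P f2. map g2 y = w}) = card (?P f2) / card (?P f0)" if "w \<in> ?P f0" for w
      using card_permutations_of_multiset_fibre[of w g1 "image_mset f1 M"]
        card_permutations_of_multiset_fibre[of w g2 "image_mset f2 M"] that ne
      unfolding im1 im2 by (simp_all add: field_simps flip: of_nat_mult)
    have "real (card Z) = (\<Sum>w\<in>?P f0. real (card {y \<in> ?P f1. map g1 y = w}) * real (card {y \<in> ?P f2. map g2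
        y = w}))"
      unfolding Z_def by (subst card_SigmaI) auto
    also have "\<dots> = (\<Sum>w\<in>?P f0. (card (?P f1) / card (?P f0)) * (card (?P f2) / card (?P f0)))"
      using F by (intro sum.cong) auto
    also have "\<dots> = card (?P f1) * card (?P f2) / card (?P f0)" using ne by simp
    finally have "real (card Z) * card (?P f0) = card (?P f1) * card (?P f2)" using ne by (simp add:
        field_simps)
    thus ?thesis by (metis of_nat_eq_iff of_nat_mult)
  qed
  \<comment> \<open>\<open>f1\<close> and \<open>f2\<close> need not factor through
    \<open>f\<close>, so the images are read off a chosen preimage. Injectivity holds for any
    choice, because the two images recover the \<open>f\<close> image position by position.\<close>
  define h where "h = (\<lambda>y. let xs = (SOME xs. xs \<in> ?M \<and> map f xs = y) in (map f0 xs, map f1 xs, map f2 xs))"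
  have S: "\<exists>xs. xs \<in> ?M \<and> map f xs = y \<and> h y = (map f0 xs, map f1 xs, map f2 xs)" if "y \<in> ?P f" for y
  proof -
    have "\<exists>xs. xs \<in> ?M \<and> map f xs = y" using that P[of f] by auto
    from someI_ex[OF this] show ?thesis unfolding h_def Let_def by blast
  qed
  have "inj_on h (?P f)"
  proof (rule inj_onI)
    fix y z assume a: "y \<in> ?P f" "z \<in> ?P f" "h y = h z"
    obtain xs where x: "xs \<in> ?M" "map f xs = y" "h y = (map f0 xs, map f1 xs, map f2 xs)" using S a by blast
    obtain xs' where x': "xs' \<in> ?M" "map f xs' = z" "h z = (map f0 xs', map f1 xs', map f2 xs')" using S a
        by blast
    have e: "map f1 xs = map f1 xs'" "map f2 xs = map f2 xs'" using a x x' by auto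
    have l: "length xs = length xs'" using e map_eq_imp_length_eq by blast
    have "map f xs = map f xs'"
    proof (rule nth_equalityI)
      fix i assume "i < length (map f xs)"
      hence i: "i < length xs" "i < length xs'" using l by auto
      have "f1 (xs ! i) = f1 (xs' ! i)" "f2 (xs ! i) = f2 (xs' ! i)"
        using e i by (metis nth_map)+
      moreover have "xs ! i \<in># M" "xs' ! i \<in># M" using set x(1) x'(1) i nth_mem by blast+
      ultimately show "map f xs ! i = map f xs' ! i" using inj[of "xs ! i" "xs' ! i"] i by simp
    qed (use l in simp)
    thus "y = z" using x x' by simp
  qed
  moreover have "h ` ?P f \<subseteq> Z"
  proof
    fix z assume "z \<in> h ` ?P f"
    then obtain xs where x: "xs \<in> ?M" "z = (map f0 xs, map f1 xs, map f2 xs)" using S by fastforce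
    have "map f0 xs \<in> ?P f0" "map f1 xs \<in> ?P f1" "map f2 xs \<in> ?P f2" using x P by auto
    thus "z \<in> Z" unfolding x(2) Z_def using m1[OF x(1)] m2[OF x(1)] by simp
  qed
  moreover have "finite Z" unfolding Z_def by auto
  ultimately have "card (?P f) \<le> card Z" by (rule card_inj_on_le)
  hence "card (?P f) * card (?P f0) \<le> card Z * card (?P f0)" by simp
  thus ?thesis using cZ by simp
qed

text \<open>For a concave sequence with \<open>b 0 = 0\<close> the quotient \<open>b s / s\<close>
  decreases; multiplying out the denominators includes \<open>s = 0\<close>. In the application
  \<open>b\<close> is the logarithm of a log-concave count.\<close>

lemma log_concave_mult_le:
  fixes b :: "nat \<Rightarrow> real"
  assumes b0: "b 0 = 0" and lc: "\<And>s. Suc (Suc s) \<le> t \<Longrightarrow> b (Suc (Suc s)) + b s \<le> 2 * b (Suc s)"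
    and "s \<le> t"
  shows "real s * b t \<le> real t * b s"
proof -
  have ratio: "real s * b (Suc s) \<le> real (Suc s) * b s" if "Suc s \<le> t" for s
    using that
  proof (induction s)
    case (Suc s)
    have "real (Suc s) * (b (Suc (Suc s)) + b s) \<le> real (Suc s) * (2 * b (Suc s))"
      using lc Suc.prems by (intro mult_left_mono) auto
    with Suc show ?case by (simp add: algebra_simps)
  qed (simp add: b0)
  have "real s * b u \<le> real u * b s" if "s \<le> u" "u \<le> t" for u
    using that
  proof (induction u rule: dec_induct)
    case (step n)
    show ?case
    proof (cases "n = 0")
      case False
      have "real s * (real n * b (Suc n)) \<le> real s * (real (Suc n) * b n)"
        using ratio[of n] step.prems by (intro mult_left_mono) auto
      also have "\<dots> = real (Suc n) * (real s * b n)" by (simp only: ac_simps)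
      also have "\<dots> \<le> real (Suc n) * (real n * b s)"
        using step by (intro mult_left_mono) auto
      finally have "real n * (real s * b (Suc n)) \<le> real n * (real (Suc n) * b s)"
        by (simp only: ac_simps)
      thus ?thesis using False by (simp add: mult_le_cancel_left)
    qed (use step b0 in auto)
  qed simp
  thus ?thesis using assms(3) by simp
qed

section \<open>Finite tuples and linear subspaces of functions\<close>

text \<open>Padding with 0 rather than an undefined value makes tuples over subgroups a subgroup
  under pointwise operations. It also allows the letters of a tuple to be tuples themselves.\<close>

definition tuples :: "nat \<Rightarrow> (nat \<Rightarrow> 'b::zero set) \<Rightarrow> (nat \<Rightarrow> 'b) set" where
  "tuples n S = {f. (\<forall>j<n. f j \<in> S j) \<and> (\<forall>j\<ge>n. f j = 0)}"

lemma tuplesI: "(\<And>j. j < n \<Longrightarrow> f j \<in> S j) \<Longrightarrow> (\<And>j. j \<ge> n \<Longrightarrow> f j = 0) \<Longrightarrow> f \<in> tuples n S"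
  by (auto simp: tuples_def)

lemma bij_betw_tuples_PiE: "bij_betw (\<lambda>f. restrict f {..<n}) (tuples n S) (PiE {..<n} S)"
  by (rule bij_betw_byWitness[where f' = "\<lambda>f j. if j < n then f j else 0"])
    (auto simp: tuples_def fun_eq_iff PiE_def Pi_def extensional_def)

lemma finite_tuples: "(\<And>j. j < n \<Longrightarrow> finite (S j)) \<Longrightarrow> finite (tuples n S)"
  using bij_betw_finite[OF bij_betw_tuples_PiE, of n S] by (auto intro: finite_PiE)

lemma card_tuples: "card (tuples n S) = (\<Prod>j<n. card (S j))"
  using bij_betw_same_card[OF bij_betw_tuples_PiE, of n S] by (simp add: card_PiE)

section \<open>Finite subspaces of one ambient function space\<close>

interpretation fun_vs: vector_space "\<lambda>(c::'a::field) (x::nat \<Rightarrow> 'a) i. c * x i"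
  by unfold_locales (auto simp: fun_eq_iff algebra_simps)

lemma subspace_tuples: "fun_vs.subspace (tuples t (\<lambda>_. UNIV))"
  by (auto simp: fun_vs.subspace_def tuples_def)

text \<open>Adjoining a vector outside the span multiplies the cardinality by the field size: the
  scalar in front of the new vector is unique.\<close>

lemma card_fun_span:
  fixes S :: "(nat \<Rightarrow> 'a::{field,finite}) set"
  assumes "finite S"
  shows "finite (fun_vs.span S) \<and> (\<exists>d. card (fun_vs.span S) = CARD('a) ^ d)"
  using assms
proof induction
  case empty
  show ?case by (auto intro!: exI[of _ 0])
next
  case (insert a S)
  show ?case
  proof (cases "a \<in> fun_vs.span S")
    case True
    thus ?thesis using insert fun_vs.span_redundant by metis
  next
    case False
    define h where "h = (\<lambda>(c::'a, y). (\<lambda>i. c * a i) + y)"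
    have inj: "inj_on h (UNIV \<times> fun_vs.span S)"
    proof (rule inj_onI, clarsimp simp: h_def)
      fix c c' y y' assume y: "y \<in> fun_vs.span S" "y' \<in> fun_vs.span S"
        and e: "(\<lambda>i. c * a i) + y = (\<lambda>i. c' * a i) + y'"
      have d: "(\<lambda>i. (c - c') * a i) = y' - y" using e
        by (auto simp: fun_eq_iff algebra_simps)
      have "c = c'"
      proof (rule ccontr)
        assume "c \<noteq> c'"
        have "(\<lambda>i. (c - c') * a i) \<in> fun_vs.span S" unfolding d using y by (rule fun_vs.span_diff[rotated])
        hence "(\<lambda>i. inverse (c - c') * ((c - c') * a i)) \<in> fun_vs.span S" by (rule fun_vs.span_scale)
        thus False using False \<open>c \<noteq> c'\<close> by (simp add: mult.assoc[symmetric])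
      qed
      thus "c = c' \<and> y = y'" using e by simp
    qed
    have im: "h ` (UNIV \<times> fun_vs.span S) = fun_vs.span (insert a S)"
    proof (intro equalityI subsetI)
      fix x assume "x \<in> fun_vs.span (insert a S)"
      then obtain k where "x - (\<lambda>i. k * a i) \<in> fun_vs.span S" by (auto simp: fun_vs.span_insert)
      moreover have "x = h (k, x - (\<lambda>i. k * a i))" by (simp add: h_def)
      ultimately show "x \<in> h ` (UNIV \<times> fun_vs.span S)" by blast
    next
      fix x assume "x \<in> h ` (UNIV \<times> fun_vs.span S)"
      then obtain c y where y: "y \<in> fun_vs.span S" "x = (\<lambda>i. c * a i) + y" by (auto simp: h_def)
      hence "x - (\<lambda>i. c * a i) \<in> fun_vs.span S" by simp
      thus "x \<in> fun_vs.span (insert a S)" unfolding fun_vs.span_insert by blast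
    qed
    obtain d where d: "card (fun_vs.span S) = CARD('a) ^ d" using insert by blast
    have "card (fun_vs.span (insert a S)) = CARD('a) ^ Suc d"
      using card_image[OF inj] unfolding im by (simp add: card_cartesian_product d)
    moreover have "finite (fun_vs.span (insert a S))" using insert unfolding im[symmetric] by auto
    ultimately show ?thesis by blast
  qed
qed

lemma card_fun_subspace:
  fixes U :: "(nat \<Rightarrow> 'a::{field,finite}) set"
  assumes "fun_vs.subspace U" "finite U"
  shows "\<exists>d. card U = CARD('a) ^ d"
proof -
  have "fun_vs.span U = U" using assms(1) by (simp only: fun_vs.span_eq_iff)
  thus ?thesis using card_fun_span[OF assms(2)] by metis
qed

text \<open>Nonempty fibres of a homomorphism are translates of its kernel. Closure under
  differences is what makes \<open>G\<close> a subgroup here, and \<open>h\<close> is additive only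
  on \<open>G\<close>.\<close>

lemma card_fibre_additive:
  fixes h :: "'b::ab_group_add \<Rightarrow> 'c::ab_group_add"
  assumes "finite G" and diff: "\<And>x y. x \<in> G \<Longrightarrow> y \<in> G \<Longrightarrow> x - y \<in> G"
    and h: "\<And>x y. x \<in> G \<Longrightarrow> y \<in> G \<Longrightarrow> h (x - y) = h x - h y" and v: "v \<in> h ` G"
  shows "card {g \<in> G. h g = v} * card (h ` G) = card G"
proof -
  have 0: "0 \<in> G" using v diff by (metis diff_self imageE)
  have add: "x + y \<in> G" if "x \<in> G" "y \<in> G" for x y
    using diff[OF that(1) diff[OF 0 that(2)]] by simp
  have hadd: "h (x + y) = h x + h y" if "x \<in> G" "y \<in> G" for x y
    using h[OF add[OF that] that(2)] by simp
  have eq: "card {g \<in> G. h g = w} = card {g \<in> G. h g = 0}" if "w \<in> h ` G" for w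
  proof -
    from that obtain a where a: "a \<in> G" "h a = w" by auto
    have "bij_betw (\<lambda>g. g - a) {g \<in> G. h g = w} {g \<in> G. h g = 0}"
      by (rule bij_betw_byWitness[where f' = "\<lambda>g. g + a"]) (use a add hadd diff h in auto)
    thus ?thesis by (rule bij_betw_same_card)
  qed
  have "card G = (\<Sum>w\<in>h ` G. card {g \<in> G. h g = w})"
    using assms(1) by (intro card_eq_sum_fibres) auto
  also have "\<dots> = (\<Sum>w\<in>h ` G. card {g \<in> G. h g = v})"
    using eq v by (intro sum.cong) auto
  finally show ?thesis by simp
qed

text \<open>Prescribing the same multiplicity \<open>m\<close> for all nonzero columns is what makes the number of words modulo a
  subspace depend only on the size of that subspace.\<close>

definition column_mset :: "nat \<Rightarrow> nat \<Rightarrow> 'b::zero set \<Rightarrow> 'b multiset" where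
  "column_mset m z V = (\<Sum>v\<in>V - {0}. replicate_mset m v) + replicate_mset z 0"

lemma count_column_mset:
  "finite V \<Longrightarrow> count (column_mset m z V) v = (if v = 0 then z else if v \<in> V then m else 0)"
  by (auto simp: column_mset_def count_sum sum.delta)

lemma size_column_mset:
  assumes "finite V" "0 \<in> V"
  shows "size (column_mset m z V) = (card V - 1) * m + z"
  using assms by (simp add: column_mset_def size_multiset_sum)

text \<open>This is a multinomial coefficient with the denominator moved to the left. Each fibre of
  \<open>f\<close> merges \<open>c\<close> letters: the one containing 0 has total multiplicity
  \<open>z + (c - 1) * m\<close>, and each of the other \<open>card V div c - 1\<close> has
  \<open>c * m\<close>. Hence \<open>f\<close> matters only through its fibre size.\<close>

lemma card_permutations_column_mset:
  assumes V: "finite V" "0 \<in> V" and f: "\<And>v. v \<in> V \<Longrightarrow> card {w \<in> V. f w = f v} = c"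
  shows "card (permutations_of_multiset (image_mset f (column_mset m z V)))
    * (fact (c * m) ^ (card V div c - 1) * fact (z + (c - 1) * m)) = fact ((card V - 1) * m + z)"
proof -
  let ?M = "column_mset m z V"
  have supp: "set_mset ?M \<subseteq> V"
    using V by (auto simp: count_column_mset split: if_splits simp flip: count_greater_zero_iff)
  have cpos: "c > 0" using f[OF V(2)] V by (auto simp: card_gt_0_iff)
  have "card V = (\<Sum>y\<in>f ` V. card {w \<in> V. f w = y})"
    using V by (intro card_eq_sum_fibres) auto
  also have "\<dots> = (\<Sum>y\<in>f ` V. c)" using f by (intro sum.cong) auto
  finally have cV: "card V div c = card (f ` V)" using cpos by simp
  have count: "count (image_mset f ?M) y = (if y = f 0 then z + (c - 1) * m else c * m)" if "y \<in> f ` V" for y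
  proof -
    have F: "card {w \<in> V. f w = y} = c" using that f by auto
    have "count (image_mset f ?M) y = (\<Sum>x\<in>{w \<in> V. f w = y}. count ?M x)"
      unfolding count_image_mset
      using V supp by (intro sum.mono_neutral_left) (auto simp: not_in_iff)
    also have "\<dots> = (if y = f 0 then z + (c - 1) * m else c * m)"
    proof (cases "y = f 0")
      case True
      have "(\<Sum>x\<in>{w \<in> V. f w = y}. count ?M x) = count ?M 0 + (\<Sum>x\<in>{w \<in> V. f w = y} - {0}. count ?M x)"
        using V True by (intro sum.remove) auto
      also have "(\<Sum>x\<in>{w \<in> V. f w = y} - {0}. count ?M x) = (\<Sum>x\<in>{w \<in> V. f w = y} - {0}. m)"
        using V by (intro sum.cong) (auto simp: count_column_mset)
      also have "\<dots> = (c - 1) * m" using F V True by (simp add: card_Diff_singleton)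
      finally show ?thesis using True V by (simp add: count_column_mset)
    next
      case False
      hence "(\<Sum>x\<in>{w \<in> V. f w = y}. count ?M x) = (\<Sum>x\<in>{w \<in> V. f w = y}. m)"
        using V by (intro sum.cong) (auto simp: count_column_mset)
      thus ?thesis using F False by simp
    qed
    finally show ?thesis .
  qed
  have sub: "set_mset (image_mset f ?M) \<subseteq> f ` V" using supp by auto
  have "(\<Prod>y\<in>set_mset (image_mset f ?M). fact (count (image_mset f ?M) y) :: nat)
      = (\<Prod>y\<in>f ` V. fact (count (image_mset f ?M) y))"
    using V sub by (intro prod.mono_neutral_left) (auto simp: not_in_iff simp del: set_image_mset)
  also have "\<dots> = (\<Prod>y\<in>f ` V. fact (if y = f 0 then z + (c - 1) * m else c * m))"
    using count by (intro prod.cong) auto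
  also have "\<dots> = fact (z + (c - 1) * m) * (\<Prod>y\<in>f ` V - {f 0}. fact (c * m))"
    using V by (subst prod.remove[of _ "f 0"]) (auto intro!: prod.cong)
  also have "(\<Prod>y\<in>f ` V - {f 0}. fact (c * m) :: nat) = fact (c * m) ^ (card V div c - 1)"
    using V by (simp add: cV card_Diff_singleton)
  finally have "(\<Prod>y\<in>set_mset (image_mset f ?M). fact (count (image_mset f ?M) y) :: nat)
    = fact (c * m) ^ (card V div c - 1) * fact (z + (c - 1) * m)" by simp
  moreover have "size (image_mset f ?M) = (card V - 1) * m + z"
    using size_column_mset[OF V, of m z] by simp
  ultimately show ?thesis
    using card_permutations_of_multiset_aux[of "image_mset f ?M"] by (simp only: )
qed

section \<open>Equidistributed words and their reductions\<close>

abbreviation coords :: "nat \<Rightarrow> (nat \<Rightarrow> 'a::zero) set" where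
  "coords t \<equiv> tuples t (\<lambda>_. UNIV)"

lemma finite_coords: "finite (coords t :: (nat \<Rightarrow> 'a::{zero,finite}) set)"
  by (rule finite_tuples) simp

lemma card_coords: "card (coords t :: (nat \<Rightarrow> 'a::{zero,finite}) set) = CARD('a) ^ t"
  by (simp add: card_tuples)

lemma zero_coords: "0 \<in> coords t"
  by (simp add: tuples_def)

text \<open>A concrete model of reduction modulo the subspace of vectors in \<open>coords t\<close>
  that vanish on \<open>S\<close>, of codimension \<open>card S\<close> when \<open>S\<close> lies
  in \<open>{..<t}\<close>.\<close>

definition coord_restrict :: "nat set \<Rightarrow> (nat \<Rightarrow> 'a::zero) \<Rightarrow> nat \<Rightarrow> 'a" where
  "coord_restrict S v = (\<lambda>i. if i \<in> S then v i else 0)"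

lemma card_coord_restrict_fibre:
  fixes v :: "nat \<Rightarrow> 'a::{zero,finite}"
  assumes "v \<in> coords t" "S \<subseteq> {..<t}"
  shows "card {w \<in> coords t. coord_restrict S w = coord_restrict S v} = CARD('a) ^ (t - card S)"
proof -
  have "{w \<in> coords t. coord_restrict S w = coord_restrict S v} = tuples t (\<lambda>i. if i \<in> S then {v i} else UNIV)"
  proof (intro equalityI subsetI)
    fix w assume w: "w \<in> {w \<in> coords t. coord_restrict S w = coord_restrict S v}"
    hence "w i = v i" if "i \<in> S" for i
    proof -
      have "coord_restrict S w i = coord_restrict S v i" using w by simp
      thus ?thesis using that by (simp add: coord_restrict_def)
    qed
    thus "w \<in> tuples t (\<lambda>i. if i \<in> S then {v i} else UNIV)" using w by (auto simp: tuples_def)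
  next
    fix w assume w: "w \<in> tuples t (\<lambda>i. if i \<in> S then {v i} else UNIV)"
    hence "w i = v i" if "i \<in> S" for i using that assms(2) by (auto simp: tuples_def split: if_splits)
    thus "w \<in> {w \<in> coords t. coord_restrict S w = coord_restrict S v}"
      using w by (auto simp: tuples_def coord_restrict_def)
  qed
  also have "card \<dots> = (\<Prod>j<t. if j \<in> S then 1 else CARD('a))"
    unfolding card_tuples by (intro prod.cong) auto
  also have "\<dots> = CARD('a) ^ card ({..<t} - S)"
    by (simp add: prod.If_cases Int_commute Diff_eq)
  also have "card ({..<t} - S) = t - card S"
    using assms(2) by (simp add: card_Diff_subset finite_subset)
  finally show ?thesis .
qed

text \<open>The set of all \<open>x\<close> with \<open>x - v \<in> U\<close> is the coset of
  \<open>v\<close>, so this map is the quotient map modulo \<open>U\<close>. Its fibre within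
  \<open>V\<close> is \<open>v + U\<close>.\<close>

lemma card_coset_fibre:
  fixes U :: "(nat \<Rightarrow> 'a::{field,finite}) set"
  assumes U: "fun_vs.subspace U" "U \<subseteq> V" and V: "fun_vs.subspace V" and v: "v \<in> V"
  shows "card {w \<in> V. {x. x - w \<in> U} = {x. x - v \<in> U}} = card U"
proof -
  have "{w \<in> V. {x. x - w \<in> U} = {x. x - v \<in> U}} = (\<lambda>u. v + u) ` U"
  proof (intro equalityI subsetI)
    fix w assume w: "w \<in> {w \<in> V. {x. x - w \<in> U} = {x. x - v \<in> U}}"
    have "w - w \<in> U" using U by (simp add: fun_vs.subspace_0)
    hence "w - v \<in> U" using w by blast
    moreover have "w = v + (w - v)" by simp
    ultimately show "w \<in> (\<lambda>u. v + u) ` U" by (intro image_eqI[where x = "w - v"])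
  next
    fix w assume "w \<in> (\<lambda>u. v + u) ` U"
    then obtain u where u: "u \<in> U" "w = v + u" by auto
    have "x - w \<in> U \<longleftrightarrow> x - v \<in> U" for x
    proof
      assume "x - w \<in> U"
      hence "(x - w) + u \<in> U" using fun_vs.subspace_add[OF U(1)] u(1) by blast
      thus "x - v \<in> U" by (simp add: u algebra_simps)
    next
      assume "x - v \<in> U"
      hence "(x - v) - u \<in> U" using fun_vs.subspace_diff[OF U(1)] u(1) by blast
      thus "x - w \<in> U" by (simp add: u algebra_simps)
    qed
    moreover have "w \<in> V" using u U v V by (auto intro: fun_vs.subspace_add)
    ultimately show "w \<in> {w \<in> V. {x. x - w \<in> U} = {x. x - v \<in> U}}" by simp
  qed
  thus ?thesis by (simp add: card_image inj_on_def)
qed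

text \<open>With \<open>M\<close> a \<open>column_mset\<close> over \<open>coords t\<close> this is
  the set \<open>T\<close> of the overview. Functions replace lists because words must be added and
  subtracted.\<close>

definition words :: "nat \<Rightarrow> 'b::zero multiset \<Rightarrow> (nat \<Rightarrow> 'b) set" where
  "words n M = {e \<in> tuples n (\<lambda>_. set_mset M). mset (map e [0..<n]) = M}"

lemma bij_betw_words:
  assumes "size M = n"
  shows "bij_betw (\<lambda>e. map e [0..<n]) (words n M) (permutations_of_multiset M)"
proof (rule bij_betw_byWitness[where f' = "\<lambda>xs j. if j < n then xs ! j else 0"])
  show "\<forall>e\<in>words n M. (\<lambda>j. if j < n then map e [0..<n] ! j else 0) = e"
    by (auto simp: words_def tuples_def fun_eq_iff)
  have len: "length xs = n" if "xs \<in> permutations_of_multiset M" for xs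
    using that assms by (auto simp: permutations_of_multiset_def)
  have map: "map (\<lambda>j. if j < n then xs ! j else 0) [0..<n] = xs" if "xs \<in> permutations_of_multiset M" for xs
    using len[OF that] by (intro nth_equalityI) auto
  thus "\<forall>xs\<in>permutations_of_multiset M. map (\<lambda>j. if j < n then xs ! j else 0) [0..<n] = xs" by blast
  show "(\<lambda>e. map e [0..<n]) ` words n M \<subseteq> permutations_of_multiset M"
    by (auto simp: words_def permutations_of_multiset_def)
  show "(\<lambda>xs j. if j < n then xs ! j else 0) ` permutations_of_multiset M \<subseteq> words n M"
  proof
    fix e assume "e \<in> (\<lambda>xs j. if j < n then xs ! j else 0) ` permutations_of_multiset M"
    then obtain xs where xs: "xs \<in> permutations_of_multiset M" "e = (\<lambda>j. if j < n then xs ! j else 0)" by auto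
    have m: "mset xs = M" using xs by (simp add: permutations_of_multiset_def)
    have "xs ! j \<in># M" if "j < n" for j using that len[OF xs(1)] m by (metis nth_mem set_mset_mset)
    moreover have "mset (map e [0..<n]) = M" unfolding xs(2) map[OF xs(1)] by (rule m)
    ultimately show "e \<in> words n M" unfolding words_def tuples_def by (simp add: xs(2))
  qed
qed

lemma card_words: "size M = n \<Longrightarrow> card (words n M) = card (permutations_of_multiset M)"
  by (rule bij_betw_same_card[OF bij_betw_words])

text \<open>Two words differ by an element of \<open>U\<close> in every position exactly when their
  reductions modulo \<open>U\<close> coincide. The count is therefore a fibre size of the reduction
  and does not depend on \<open>e\<close>.\<close>

lemma card_words_fibre:
  fixes U :: "(nat \<Rightarrow> 'a::{field,finite}) set"
  assumes "size M = n" and U: "fun_vs.subspace U" and e: "e \<in> words n M"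
  shows "card {e' \<in> words n M. e' - e \<in> tuples n (\<lambda>_. U)}
    * card (permutations_of_multiset (image_mset (\<lambda>v. {x. x - v \<in> U}) M)) = card (words n M)"
proof -
  let ?f = "\<lambda>v. {x. x - v \<in> U}" and ?L = "\<lambda>e. map e [0..<n]"
  have f: "?f v = ?f w \<longleftrightarrow> v - w \<in> U" for v w
  proof
    assume "?f v = ?f w"
    moreover have "v \<in> ?f v" using U by (simp add: fun_vs.subspace_0)
    ultimately show "v - w \<in> U" by blast
  next
    assume a: "v - w \<in> U"
    have "x - v \<in> U \<longleftrightarrow> x - w \<in> U" for x
      using fun_vs.subspace_add[OF U, of "x - v" "v - w"] fun_vs.subspace_diff[OF U, of "x - w" "v - w"] a
      by auto
    thus "?f v = ?f w" by simp
  qed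
  have iff: "e' - e \<in> tuples n (\<lambda>_. U) \<longleftrightarrow> map ?f (?L e') = map ?f (?L e)" if "e' \<in> words n M" for e'
  proof -
    have "e' j = 0" "e j = 0" if "j \<ge> n" for j using that \<open>e' \<in> words n M\<close> e by (auto simp: words_def
        tuples_def)
    hence "e' - e \<in> tuples n (\<lambda>_. U) \<longleftrightarrow> (\<forall>j<n. e' j - e j \<in> U)" by (auto simp: tuples_def)
    also have "\<dots> \<longleftrightarrow> (\<forall>j<n. ?f (e' j) = ?f (e j))" using f by simp
    finally show ?thesis by (auto simp: list_eq_iff_nth_eq)
  qed
  have b: "bij_betw ?L (words n M) (permutations_of_multiset M)" by (rule bij_betw_words[OF assms(1)])
  have im: "?L ` {e' \<in> words n M. e' - e \<in> tuples n (\<lambda>_. U)}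
    = {xs \<in> permutations_of_multiset M. map ?f xs = map ?f (?L e)}" (is "?L ` ?A = ?B")
  proof -
    have "?A = {e' \<in> words n M. map ?f (?L e') = map ?f (?L e)}" using iff by blast
    moreover have "?L ` {e' \<in> words n M. map ?f (?L e') = map ?f (?L e)} = ?B"
      unfolding bij_betw_imp_surj_on[OF b, symmetric] by blast
    ultimately show ?thesis by simp
  qed
  have "inj_on ?L ?A" by (rule inj_on_subset[OF bij_betw_imp_inj_on[OF b]]) auto
  hence "card ?A = card ?B" unfolding im[symmetric] by (simp add: card_image)
  moreover have "map ?f (?L e) \<in> permutations_of_multiset (image_mset ?f M)"
  proof -
    have "?L e \<in> permutations_of_multiset M" using b e by (auto simp: bij_betw_def)
    thus ?thesis unfolding permutations_of_multiset_image by (rule imageI)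
  qed
  ultimately show ?thesis
    using card_permutations_of_multiset_fibre[of "map ?f (?L e)" ?f M] card_words[OF assms(1)] by simp
qed

text \<open>Number of words modulo a subspace of codimension \<open>s\<close>, represented by restriction to the first \<open>s\<close> rows.\<close>

definition shadow_card :: "'a::{field,finite} itself \<Rightarrow> nat \<Rightarrow> nat \<Rightarrow> nat \<Rightarrow> nat \<Rightarrow> nat" where
  "shadow_card F t m z s =
     card (permutations_of_multiset (image_mset (coord_restrict {..<s}) (column_mset m z (coords t :: (nat
         \<Rightarrow> 'a) set))))"

text \<open>Both counts are the same multinomial coefficient, since \<open>f\<close> and the
  coordinate restriction have fibres of the same size.\<close>

lemma shadow_card_unique:
  fixes f :: "(nat \<Rightarrow> 'a::{field,finite}) \<Rightarrow> 'x"
  assumes "\<And>v. v \<in> coords t \<Longrightarrow> card {w \<in> coords t. f w = f v} = CARD('a) ^ (t - s)" "s \<le> t"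
  shows "card (permutations_of_multiset (image_mset f (column_mset m z (coords t)))) = shadow_card
      TYPE('a) t m z s"
proof -
  let ?c = "CARD('a) ^ (t - s)" and ?V = "coords t :: (nat \<Rightarrow> 'a) set"
  let ?K = "fact (?c * m) ^ (card ?V div ?c - 1) * fact (z + (?c - 1) * m) :: nat"
  have "card (permutations_of_multiset (image_mset f (column_mset m z ?V))) * ?K = fact ((card ?V - 1) * m + z)"
    by (rule card_permutations_column_mset) (use finite_coords zero_coords assms(1) in auto)
  moreover have "shadow_card TYPE('a) t m z s * ?K = fact ((card ?V - 1) * m + z)"
    unfolding shadow_card_def
  proof (rule card_permutations_column_mset)
    fix v :: "nat \<Rightarrow> 'a" assume "v \<in> coords t"
    thus "card {w \<in> coords t. coord_restrict {..<s} w = coord_restrict {..<s} v} = ?c"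
      using card_coord_restrict_fibre[of v t "{..<s}"] assms(2) by simp
  qed (use finite_coords zero_coords in auto)
  moreover have "?K \<noteq> 0" by simp
  ultimately show ?thesis by (metis mult_right_cancel)
qed

lemma shadow_card_pos: "shadow_card F t m z s > 0"
  by (simp add: shadow_card_def card_gt_0_iff)

lemma shadow_card_0: "shadow_card F t m z 0 = 1"
proof -
  have "image_mset (coord_restrict {..<0}) M = replicate_mset (size M) (\<lambda>_. 0)" for M :: "(nat \<Rightarrow> 'a) multiset"
    by (induction M) (auto simp: coord_restrict_def)
  moreover have "permutations_of_multiset (replicate_mset k x) = {replicate k x}" for k and x :: "nat \<Rightarrow> 'a"
  proof (intro equalityI subsetI)
    fix xs assume "xs \<in> permutations_of_multiset (replicate_mset k x)"
    hence m: "mset xs = replicate_mset k x" by (simp add: permutations_of_multiset_def)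
    have "length xs = k" using arg_cong[OF m, of size] by simp
    moreover have "y = x" if "y \<in> set xs" for y
      using that arg_cong[OF m, of set_mset] by (auto split: if_splits)
    ultimately show "xs \<in> {replicate k x}" by (auto intro: replicate_eqI)
  qed (auto simp: permutations_of_multiset_def)
  ultimately show ?thesis by (simp add: shadow_card_def)
qed

lemma shadow_card_full:
  "shadow_card TYPE('a::{field,finite}) t m z t = card (permutations_of_multiset (column_mset m z (coords
      t :: (nat \<Rightarrow> 'a) set)))"
proof -
  have "coord_restrict {..<t} v = v" if "v \<in># column_mset m z (coords t)" for v :: "nat \<Rightarrow> 'a"
  proof -
    have "v \<in> coords t" using that zero_coords[of t]
      by (auto simp: count_column_mset finite_coords split: if_splits simp flip: count_greater_zero_iff)
    thus ?thesis by (auto simp: coord_restrict_def tuples_def fun_eq_iff)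
  qed
  hence "image_mset (coord_restrict {..<t}) (column_mset m z (coords t)) = column_mset m z (coords t ::
      (nat \<Rightarrow> 'a) set)"
    by (simp cong: image_mset_cong)
  thus ?thesis by (simp add: shadow_card_def)
qed

text \<open>Submodularity is applied to the coordinate sets \<open>{..<Suc s}\<close> and
  \<open>insert (Suc s) {..<s}\<close>: their union is \<open>{..<Suc (Suc s)}\<close> and their
  intersection \<open>{..<s}\<close>. Both have \<open>Suc s\<close> elements, so by uniqueness both
  give the same count.\<close>

lemma shadow_card_log_concave:
  assumes "Suc (Suc s) \<le> t"
  shows "shadow_card TYPE('a::{field,finite}) t m z (Suc (Suc s)) * shadow_card TYPE('a) t m z s \<le>
      shadow_card TYPE('a) t m z (Suc s) ^ 2"
proof -
  let ?M = "column_mset m z (coords t :: (nat \<Rightarrow> 'a) set)"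
  let ?S = "insert (Suc s) {..<s}"
  have P: "card (permutations_of_multiset (image_mset (coord_restrict ?S) ?M)) = shadow_card TYPE('a) t m
      z (Suc s)"
  proof (rule shadow_card_unique)
    fix v :: "nat \<Rightarrow> 'a" assume "v \<in> coords t"
    moreover have "?S \<subseteq> {..<t}" "card ?S = Suc s" using assms by auto
    ultimately show "card {w \<in> coords t. coord_restrict ?S w = coord_restrict ?S v} = CARD('a) ^ (t - Suc s)"
      using card_coord_restrict_fibre[of v t ?S] by simp
  qed (use assms in simp)
  have "shadow_card TYPE('a) t m z (Suc (Suc s)) * shadow_card TYPE('a) t m z s
    \<le> shadow_card TYPE('a) t m z (Suc s) * card (permutations_of_multiset (image_mset (coord_restrict ?S) ?M))"
    unfolding shadow_card_def
  proof (rule card_permutations_of_multiset_submodular[where ?g1.0 = "coord_restrict {..<s}" and ?g2.0 =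
      "coord_restrict {..<s}"])
    fix x y :: "nat \<Rightarrow> 'a"
    assume a: "coord_restrict {..<Suc s} x = coord_restrict {..<Suc s} y" "coord_restrict ?S x =
        coord_restrict ?S y"
    show "coord_restrict {..<Suc (Suc s)} x = coord_restrict {..<Suc (Suc s)} y"
    proof
      fix i
      show "coord_restrict {..<Suc (Suc s)} x i = coord_restrict {..<Suc (Suc s)} y i"
        using fun_cong[OF a(1), of i] fun_cong[OF a(2), of i] by (auto simp: coord_restrict_def split:
            if_splits)
    qed
  qed (auto simp: coord_restrict_def fun_eq_iff)
  thus ?thesis unfolding P by (simp add: power2_eq_square)
qed

text \<open>The logarithm of the shadow count is concave in \<open>s\<close> and vanishes at 0, so
  it lies above the chord from 0 to \<open>t\<close>.\<close>

lemma shadow_card_ge: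
  assumes "t \<ge> 1" "s \<le> t"
  shows "(real (shadow_card TYPE('a::{field,finite}) t m z t) powr (1 / t)) ^ s \<le> real (shadow_card
      TYPE('a) t m z s)"
proof -
  let ?B = "\<lambda>s. real (shadow_card TYPE('a) t m z s)"
  have pos: "?B s > 0" for s using shadow_card_pos[of "TYPE('a)" t m z s] by simp
  have "real s * ln (?B t) \<le> real t * ln (?B s)"
  proof (rule log_concave_mult_le)
    fix s assume "Suc (Suc s) \<le> t"
    hence "?B (Suc (Suc s)) * ?B s \<le> ?B (Suc s) ^ 2"
      using shadow_card_log_concave[where 'a = 'a and s = s and t = t and m = m and z = z] by (metis
          of_nat_le_iff of_nat_mult of_nat_power)
    hence "ln (?B (Suc (Suc s)) * ?B s) \<le> ln (?B (Suc s) ^ 2)" using pos by (intro ln_mono) auto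
    thus "ln (?B (Suc (Suc s))) + ln (?B s) \<le> 2 * ln (?B (Suc s))"
      using pos by (simp add: ln_mult ln_realpow)
  qed (use assms in \<open>auto simp: shadow_card_0\<close>)
  hence "real s * (ln (?B t) / t) \<le> ln (?B s)" using assms by (simp add: field_simps)
  hence "exp (real s * (ln (?B t) / t)) \<le> exp (ln (?B s))" by (simp only: exp_le_cancel_iff)
  also have "exp (ln (?B s)) = ?B s" using pos[of s] by (simp only: exp_ln_iff of_nat_0_less_iff)
  also have "exp (real s * (ln (?B t) / t)) = (?B t powr (1 / t)) ^ s"
    unfolding exp_of_nat_mult using pos[of t] by (simp add: powr_def)
  finally show ?thesis .
qed

text \<open>Passes from coordinate subspaces to arbitrary ones: only the codimension matters for the
  count.\<close>

lemma card_quotient_permutations: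
  fixes U :: "(nat \<Rightarrow> 'a::{field,finite}) set"
  assumes "fun_vs.subspace U" "U \<subseteq> coords t" "card U = CARD('a) ^ (t - s)" "s \<le> t"
  shows "card (permutations_of_multiset (image_mset (\<lambda>v. {x. x - v \<in> U}) (column_mset m z (coords t))))
    = shadow_card TYPE('a) t m z s"
proof (rule shadow_card_unique)
  fix v :: "nat \<Rightarrow> 'a" assume "v \<in> coords t"
  from card_coset_fibre[OF assms(1,2) subspace_tuples this] assms(3)
  show "card {w \<in> coords t. {x. x - w \<in> U} = {x. x - v \<in> U}} = CARD('a) ^ (t - s)" by simp
qed (use assms in auto)

section \<open>Moments of the number of good codewords\<close>

text \<open>\<open>D\<close> is a matrix given by its columns \<open>D i\<close>, and this is its
  product with the coefficient vector \<open>g\<close>. Accordingly \<open>lin_span\<close> below is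
  the column space.\<close>

definition lin_comb :: "nat \<Rightarrow> (nat \<Rightarrow> nat \<Rightarrow> 'a::comm_ring) \<Rightarrow> (nat \<Rightarrow> 'a) \<Rightarrow> nat \<Rightarrow> 'a" where
  "lin_comb k D g = (\<lambda>r. \<Sum>i<k. g i * D i r)"

lemma lin_comb_diff: "lin_comb k D (x - y) = lin_comb k D x - lin_comb k D y"
  by (simp add: lin_comb_def fun_eq_iff algebra_simps sum_subtractf)

lemma lin_comb_add: "lin_comb k D (x + y) = lin_comb k D x + lin_comb k D y"
  by (simp add: lin_comb_def fun_eq_iff algebra_simps sum.distrib)

lemma lin_comb_add_left: "lin_comb k (A + D) g = lin_comb k A g + lin_comb k D g"
  by (simp add: lin_comb_def fun_eq_iff algebra_simps sum.distrib)

lemma lin_comb_zero [simp]: "lin_comb k D 0 = 0"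
  by (simp add: lin_comb_def fun_eq_iff)

lemma lin_comb_scale: "lin_comb k D (\<lambda>i. c * g i) = (\<lambda>r. c * lin_comb k D g r)"
  by (simp add: lin_comb_def fun_eq_iff sum_distrib_left mult.assoc)

lemma lin_comb_coords: "D \<in> tuples k (\<lambda>_. coords t) \<Longrightarrow> lin_comb k D g \<in> coords t"
  by (auto simp: lin_comb_def tuples_def)

definition lin_span :: "nat \<Rightarrow> (nat \<Rightarrow> nat \<Rightarrow> 'a::comm_ring) \<Rightarrow> (nat \<Rightarrow> 'a) set" where
  "lin_span k D = lin_comb k D ` coords k"

lemma subspace_lin_span: "fun_vs.subspace (lin_span k D)"
  unfolding fun_vs.subspace_def lin_span_def
proof (intro conjI ballI allI)
  show "0 \<in> lin_comb k D ` coords k" using zero_coords lin_comb_zero by (metis imageI)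
next
  fix x y assume "x \<in> lin_comb k D ` coords k" "y \<in> lin_comb k D ` coords k"
  then obtain g h where "g \<in> coords k" "h \<in> coords k" "x = lin_comb k D g" "y = lin_comb k D h" by auto
  moreover have "g + h \<in> coords k" using calculation by (auto simp: tuples_def)
  ultimately show "x + y \<in> lin_comb k D ` coords k" using lin_comb_add[of k D g h] by (metis imageI)
next
  fix c x assume "x \<in> lin_comb k D ` coords k"
  then obtain g where "g \<in> coords k" "x = lin_comb k D g" by auto
  moreover have "(\<lambda>i. c * g i) \<in> coords k" using calculation by (auto simp: tuples_def)
  ultimately show "(\<lambda>i. c * x i) \<in> lin_comb k D ` coords k" using lin_comb_scale[of k D c g] by (metis imageI)
qed

lemma lin_span_coords: "D \<in> tuples k (\<lambda>_. coords t) \<Longrightarrow> lin_span k D \<subseteq> coords t"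
  unfolding lin_span_def using lin_comb_coords by blast

lemma generator_in_lin_span:
  fixes D :: "nat \<Rightarrow> nat \<Rightarrow> 'a::comm_ring_1"
  assumes "i < k"
  shows "D i \<in> lin_span k D"
proof -
  let ?g = "\<lambda>j. if j = i then 1 else 0 :: 'a"
  have "lin_comb k D ?g = D i" using assms
    by (simp add: lin_comb_def fun_eq_iff if_distrib[of "\<lambda>x. x * _"] cong: if_cong)
  moreover have "?g \<in> coords k" using assms by (auto simp: tuples_def)
  ultimately show ?thesis unfolding lin_span_def by (metis imageI)
qed

lemma finite_lin_span: "finite (lin_span k (D :: nat \<Rightarrow> nat \<Rightarrow> 'a::{field,finite}))"
  by (simp add: lin_span_def finite_coords)

lemma card_lin_span_pos: "card (lin_span k (D :: nat \<Rightarrow> nat \<Rightarrow> 'a::{field,finite})) > 0"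
  using finite_lin_span[of k D] fun_vs.subspace_0[OF subspace_lin_span, of k D] by (auto simp: card_gt_0_iff)

text \<open>In probabilistic terms, a uniform coefficient vector is mapped to a uniform element of
  the column space.\<close>

lemma card_lin_comb_fibre:
  fixes D :: "nat \<Rightarrow> nat \<Rightarrow> 'a::{field,finite}"
  assumes "v \<in> lin_span k D"
  shows "real (card {g \<in> coords k. lin_comb k D g = v}) = real (CARD('a) ^ k) / card (lin_span k D)"
proof -
  have "card {g \<in> coords k. lin_comb k D g = v} * card (lin_comb k D ` coords k) = card (coords k :: (nat
      \<Rightarrow> 'a) set)"
    by (rule card_fibre_additive)
      (use assms finite_coords lin_comb_diff in \<open>auto simp: lin_span_def tuples_def\<close>)
  hence "card {g \<in> coords k. lin_comb k D g = v} * card (lin_span k D) = CARD('a) ^ k"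
    by (simp add: lin_span_def card_coords)
  hence "real (card {g \<in> coords k. lin_comb k D g = v}) * real (card (lin_span k D)) = real (CARD('a) ^ k)"
    by (simp only: of_nat_mult[symmetric])
  thus ?thesis using card_lin_span_pos[of k D] by (simp add: eq_divide_eq)
qed

text \<open>All matrices are stored by columns: column \<open>j\<close> of the product is
  \<open>A\<close> applied to column \<open>j\<close> of \<open>G\<close>.\<close>

definition mat_prod :: "nat \<Rightarrow> (nat \<Rightarrow> nat \<Rightarrow> 'a::comm_ring) \<Rightarrow> (nat \<Rightarrow> nat \<Rightarrow> 'a) \<Rightarrow> nat \<Rightarrow> nat \<Rightarrow> 'a" where
  "mat_prod k A G = (\<lambda>j. lin_comb k A (G j))"

lemma mat_prod_add_left: "mat_prod k (A + D) G = mat_prod k A G + mat_prod k D G"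
  by (simp add: mat_prod_def fun_eq_iff lin_comb_add_left)

lemma mat_prod_tuples:
  assumes "A \<in> tuples k (\<lambda>_. coords t)" "G \<in> tuples n (\<lambda>_. coords k)"
  shows "mat_prod k A G \<in> tuples n (\<lambda>_. coords t)"
proof (rule tuplesI)
  fix j show "mat_prod k A G j \<in> coords t"
    unfolding mat_prod_def using assms by (intro lin_comb_coords)
next
  fix j assume "j \<ge> n"
  hence "G j = 0" using assms by (simp add: tuples_def)
  thus "mat_prod k A G j = 0" by (simp add: mat_prod_def)
qed

text \<open>The columns of \<open>G\<close> can be chosen independently, so the count is a product
  over \<open>j < n\<close>. One column of \<open>x\<close> outside the column space of
  \<open>D\<close> rules out every \<open>G\<close>.\<close>

lemma card_mat_prod_fibre:
  fixes D :: "nat \<Rightarrow> nat \<Rightarrow> 'a::{field,finite}"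
  assumes x: "\<And>j. j \<ge> n \<Longrightarrow> x j = 0"
  shows "real (card {G \<in> tuples n (\<lambda>_. coords k). mat_prod k D G = x})
    = (if x \<in> tuples n (\<lambda>_. lin_span k D) then (real (CARD('a) ^ k) / card (lin_span k D)) ^ n else 0)"
proof (cases "x \<in> tuples n (\<lambda>_. lin_span k D)")
  case True
  have "{G \<in> tuples n (\<lambda>_. coords k). mat_prod k D G = x} = tuples n (\<lambda>j. {g \<in> coords k. lin_comb k D g = x j})"
  proof (intro equalityI subsetI)
    fix G assume "G \<in> {G \<in> tuples n (\<lambda>_. coords k). mat_prod k D G = x}"
    thus "G \<in> tuples n (\<lambda>j. {g \<in> coords k. lin_comb k D g = x j})"
      by (auto simp: tuples_def mat_prod_def)
  next
    fix G assume G: "G \<in> tuples n (\<lambda>j. {g \<in> coords k. lin_comb k D g = x j})"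
    have "mat_prod k D G j = x j" for j
    proof (cases "j < n")
      case False
      hence "G j = 0" "x j = 0" using G x by (auto simp: tuples_def)
      thus ?thesis by (simp add: mat_prod_def)
    qed (use G in \<open>simp add: tuples_def mat_prod_def\<close>)
    thus "G \<in> {G \<in> tuples n (\<lambda>_. coords k). mat_prod k D G = x}"
      using G by (auto simp: tuples_def)
  qed
  also have "real (card \<dots>) = (\<Prod>j<n. real (card {g \<in> coords k. lin_comb k D g = x j}))"
    by (simp add: card_tuples)
  also have "\<dots> = (\<Prod>j<n. real (CARD('a) ^ k) / card (lin_span k D))"
    using True by (intro prod.cong refl card_lin_comb_fibre) (auto simp: tuples_def)
  finally show ?thesis using True by simp
next
  case False
  then obtain j where j: "j < n" "x j \<notin> lin_span k D" using x by (auto simp: tuples_def)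
  have "{G \<in> tuples n (\<lambda>_. coords k). mat_prod k D G = x} = {}"
  proof (rule ccontr)
    assume "{G \<in> tuples n (\<lambda>_. coords k). mat_prod k D G = x} \<noteq> {}"
    then obtain G where "G \<in> tuples n (\<lambda>_. coords k)" "mat_prod k D G = x" by blast
    hence "x j = lin_comb k D (G j)" "G j \<in> coords k" using j by (auto simp: tuples_def mat_prod_def)
    thus False using j by (auto simp: lin_span_def)
  qed
  hence "card {G \<in> tuples n (\<lambda>_. coords k). mat_prod k D G = x} = 0" by (simp only: card.empty)
  thus ?thesis using False by (simp only: if_False of_nat_0)
qed

text \<open>Sum over the word \<open>e'\<close> that is reached. It is reachable exactly when all
  columns of \<open>e' - e\<close> lie in the column space of \<open>D\<close>, and then always by
  the same number of matrices \<open>G\<close>.\<close>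

lemma card_solutions:
  fixes D e :: "nat \<Rightarrow> nat \<Rightarrow> 'a::{field,finite}"
  assumes T: "finite T" "T \<subseteq> tuples n (\<lambda>_. coords t)" and e: "e \<in> T"
  shows "real (card {G \<in> tuples n (\<lambda>_. coords k). e + mat_prod k D G \<in> T})
    = real (card {e' \<in> T. e' - e \<in> tuples n (\<lambda>_. lin_span k D)}) * (real (CARD('a) ^ k) / card (lin_span k
        D)) ^ n"
    (is "real (card ?A) = _ * ?c")
proof -
  have fin: "finite (tuples n (\<lambda>_. coords k :: (nat \<Rightarrow> 'a) set))" by (intro finite_tuples finite_coords)
  have "card ?A = (\<Sum>e'\<in>T. card {G \<in> ?A. e + mat_prod k D G = e'})"
    using T fin by (intro card_eq_sum_fibres) auto
  hence "real (card ?A) = (\<Sum>e'\<in>T. real (card {G \<in> ?A. e + mat_prod k D G = e'}))" by simp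
  also have "\<dots> = (\<Sum>e'\<in>T. if e' - e \<in> tuples n (\<lambda>_. lin_span k D) then ?c else 0)"
  proof (rule sum.cong[OF refl])
    fix e' assume e': "e' \<in> T"
    have "e + mat_prod k D G = e' \<longleftrightarrow> mat_prod k D G = e' - e" for G
      by (auto simp: algebra_simps)
    hence "{G \<in> ?A. e + mat_prod k D G = e'} = {G \<in> tuples n (\<lambda>_. coords k). mat_prod k D G = e' - e}"
      using e' by auto
    moreover have "(e' - e) j = 0" if "j \<ge> n" for j
    proof -
      have "e' j = 0" "e j = 0" using that e e' T(2) by (auto simp: tuples_def)
      thus ?thesis by simp
    qed
    ultimately show "real (card {G \<in> ?A. e + mat_prod k D G = e'}) = (if e' - e \<in> tuples n (\<lambda>_. lin_span k
        D) then ?c else 0)"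
      using card_mat_prod_fibre[of n "e' - e" k D] by simp
  qed
  also have "\<dots> = real (card {e' \<in> T. e' - e \<in> tuples n (\<lambda>_. lin_span k D)}) * ?c"
    using T by (simp add: sum.If_cases Int_def)
  finally show ?thesis .
qed

section \<open>First and second moments\<close>

lemma tuples_coords_add:
  fixes x :: "nat \<Rightarrow> nat \<Rightarrow> 'a::ab_group_add"
  shows "x \<in> tuples n (\<lambda>_. coords t) \<Longrightarrow> y \<in> tuples n (\<lambda>_. coords t) \<Longrightarrow> x + y \<in> tuples n (\<lambda>_. coords t)"
  by (auto simp: tuples_def)

lemma tuples_coords_diff:
  fixes x :: "nat \<Rightarrow> nat \<Rightarrow> 'a::ab_group_add"
  shows "x \<in> tuples n (\<lambda>_. coords t) \<Longrightarrow> y \<in> tuples n (\<lambda>_. coords t) \<Longrightarrow> x - y \<in> tuples n (\<lambda>_. coords t)"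
  by (auto simp: tuples_def)

lemma sum_of_bool_card: "finite A \<Longrightarrow> (\<Sum>x\<in>A. of_bool (P x)) = real (card {x \<in> A. P x})"
  by (simp add: sum_of_bool_eq Int_def)

text \<open>For fixed \<open>A\<close> and \<open>G\<close>, translation by \<open>A G\<close>
  permutes all matrices, so exactly \<open>card T\<close> centres \<open>u\<close> are good.\<close>

lemma first_moment:
  fixes T :: "(nat \<Rightarrow> nat \<Rightarrow> 'a::{field,finite}) set" and k n t :: nat
  assumes T: "T \<subseteq> tuples n (\<lambda>_. coords t)"
  defines "\<G> \<equiv> tuples n (\<lambda>_. coords k :: (nat \<Rightarrow> 'a) set)" and "\<D> \<equiv> tuples k (\<lambda>_. coords t :: (nat \<Rightarrow> 'a) set)"
    and "W \<equiv> tuples n (\<lambda>_. coords t :: (nat \<Rightarrow> 'a) set)"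
  shows "(\<Sum>G\<in>\<G>. \<Sum>u\<in>W. real (card {A \<in> \<D>. mat_prod k A G + u \<in> T})) = real (card \<G>) * real (card \<D>) * real
      (card T)"
proof -
  have fin: "finite \<G>" "finite \<D>" "finite W" unfolding \<G>_def \<D>_def W_def by (intro finite_tuples finite_coords)+
  have shift: "card {u \<in> W. w + u \<in> T} = card T" if w: "w \<in> W" for w
  proof -
    have "bij_betw (\<lambda>u. w + u) {u \<in> W. w + u \<in> T} T"
      using w T by (intro bij_betw_byWitness[where f' = "\<lambda>e. e - w"]) (auto intro!: tuples_coords_diff
          simp: W_def)
    thus ?thesis by (rule bij_betw_same_card)
  qed
  have "(\<Sum>u\<in>W. real (card {A \<in> \<D>. mat_prod k A G + u \<in> T})) = real (card \<D>) * real (card T)" if "G \<in> \<G>" for G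
  proof -
    have "(\<Sum>u\<in>W. real (card {A \<in> \<D>. mat_prod k A G + u \<in> T})) = (\<Sum>u\<in>W. \<Sum>A\<in>\<D>. of_bool (mat_prod k A G + u \<in> T))"
      by (simp only: sum_of_bool_card[OF fin(2)])
    also have "\<dots> = (\<Sum>A\<in>\<D>. \<Sum>u\<in>W. of_bool (mat_prod k A G + u \<in> T))" by (rule sum.swap)
    also have "\<dots> = (\<Sum>A\<in>\<D>. real (card T))"
    proof (rule sum.cong[OF refl])
      fix A assume "A \<in> \<D>"
      hence "mat_prod k A G \<in> W" using mat_prod_tuples that unfolding \<G>_def \<D>_def W_def by blast
      thus "(\<Sum>u\<in>W. of_bool (mat_prod k A G + u \<in> T)) = real (card T)"
        using fin by (simp only: sum_of_bool_card shift)
    qed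
    finally show ?thesis by simp
  qed
  thus ?thesis by simp
qed

text \<open>The average over \<open>u\<close> turns a pair of matrices with difference
  \<open>D\<close> into the count of \<open>e \<in> T\<close> with \<open>e + D G \<in> T\<close>.
  The average over \<open>G\<close> then depends only on the column space of \<open>D\<close>;
  \<open>N U\<close> is the number of words congruent modulo \<open>U\<close> to a given word of
  \<open>T\<close>.\<close>

lemma second_moment:
  fixes T :: "(nat \<Rightarrow> nat \<Rightarrow> 'a::{field,finite}) set" and k n t :: nat
  assumes T: "T \<subseteq> tuples n (\<lambda>_. coords t)"
    and N: "\<And>U e. fun_vs.subspace U \<Longrightarrow> U \<subseteq> coords t \<Longrightarrow> e \<in> T \<Longrightarrow> real (card {e' \<in> T. e' - e \<in> tuples n (\<lambda>_.
        U)}) = N U"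
  defines "\<G> \<equiv> tuples n (\<lambda>_. coords k :: (nat \<Rightarrow> 'a) set)" and "\<D> \<equiv> tuples k (\<lambda>_. coords t :: (nat \<Rightarrow> 'a) set)"
    and "W \<equiv> tuples n (\<lambda>_. coords t :: (nat \<Rightarrow> 'a) set)"
  shows "(\<Sum>G\<in>\<G>. \<Sum>u\<in>W. (real (card {A \<in> \<D>. mat_prod k A G + u \<in> T}))\<^sup>2)
    = real (card \<D>) * (real (card T) * (\<Sum>D\<in>\<D>. N (lin_span k D) * (real (CARD('a) ^ k) / card (lin_span k
        D)) ^ n))"
proof -
  have fin: "finite \<G>" "finite \<D>" "finite W" unfolding \<G>_def \<D>_def W_def by (intro finite_tuples finite_coords)+
  have finT: "finite T" using T fin by (auto simp: W_def intro: finite_subset)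
  have shift: "card {u \<in> W. w + u \<in> T \<and> w + w' + u \<in> T} = card {e \<in> T. e + w' \<in> T}" if w: "w \<in> W" for w w'
  proof -
    have swap: "w + u + w' = w + w' + u" "w + w' + (e - w) = e + w'" for u e
      by (simp_all add: algebra_simps)
    have "bij_betw (\<lambda>u. w + u) {u \<in> W. w + u \<in> T \<and> w + w' + u \<in> T} {e \<in> T. e + w' \<in> T}"
      using w T by (intro bij_betw_byWitness[where f' = "\<lambda>e. e - w"]) (auto intro!: tuples_coords_diff
          simp: W_def swap)
    thus ?thesis by (rule bij_betw_same_card)
  qed
  have sq: "(\<Sum>u\<in>W. (real (card {A \<in> \<D>. mat_prod k A G + u \<in> T}))\<^sup>2)
      = real (card \<D>) * (\<Sum>D\<in>\<D>. real (card {e \<in> T. e + mat_prod k D G \<in> T}))" if G: "G \<in> \<G>" for G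
  proof -
    let ?p = "\<lambda>A u. of_bool (mat_prod k A G + u \<in> T) :: real"
    have "(\<Sum>u\<in>W. (real (card {A \<in> \<D>. mat_prod k A G + u \<in> T}))\<^sup>2) = (\<Sum>u\<in>W. \<Sum>A\<in>\<D>. \<Sum>A'\<in>\<D>. ?p A u * ?p A' u)"
      by (simp only: sum_of_bool_card[OF fin(2), symmetric] power2_eq_square sum_product)
    also have "\<dots> = (\<Sum>A\<in>\<D>. \<Sum>u\<in>W. \<Sum>A'\<in>\<D>. ?p A u * ?p A' u)" by (rule sum.swap)
    also have "\<dots> = (\<Sum>A\<in>\<D>. \<Sum>D\<in>\<D>. real (card {e \<in> T. e + mat_prod k D G \<in> T}))"
    proof (rule sum.cong[OF refl])
      fix A assume A: "A \<in> \<D>"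
      have w: "mat_prod k A G \<in> W" using mat_prod_tuples A G unfolding \<G>_def \<D>_def W_def by blast
      have bij: "bij_betw (\<lambda>D. A + D) \<D> \<D>"
        using A by (intro bij_betw_byWitness[where f' = "\<lambda>e. e - A"])
          (auto intro!: tuples_coords_add tuples_coords_diff simp: \<D>_def)
      have "(\<Sum>u\<in>W. \<Sum>A'\<in>\<D>. ?p A u * ?p A' u) = (\<Sum>A'\<in>\<D>. \<Sum>u\<in>W. ?p A u * ?p A' u)" by (rule sum.swap)
      \<comment> \<open>The second matrix is written as \<open>A + D\<close>; after the shift of
        \<open>u\<close> the summand no longer involves \<open>A\<close>.\<close>
      also have "\<dots> = (\<Sum>D\<in>\<D>. \<Sum>u\<in>W. ?p A u * ?p (A + D) u)"
        by (rule sum.reindex_bij_betw[OF bij, symmetric])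
      also have "\<dots> = (\<Sum>D\<in>\<D>. \<Sum>u\<in>W. of_bool (mat_prod k A G + u \<in> T \<and> mat_prod k A G + mat_prod k D G + u \<in> T))"
        by (simp add: mat_prod_add_left of_bool_conj)
      also have "\<dots> = (\<Sum>D\<in>\<D>. real (card {e \<in> T. e + mat_prod k D G \<in> T}))"
        unfolding sum_of_bool_card[OF fin(3)] shift[OF w] ..
      finally show "(\<Sum>u\<in>W. \<Sum>A'\<in>\<D>. ?p A u * ?p A' u) = (\<Sum>D\<in>\<D>. real (card {e \<in> T. e + mat_prod k D G \<in> T}))" .
    qed
    finally show ?thesis by simp
  qed
  have "(\<Sum>G\<in>\<G>. \<Sum>u\<in>W. (real (card {A \<in> \<D>. mat_prod k A G + u \<in> T}))\<^sup>2)
    = real (card \<D>) * (\<Sum>G\<in>\<G>. \<Sum>D\<in>\<D>. real (card {e \<in> T. e + mat_prod k D G \<in> T}))"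
    using sq by (simp add: sum_distrib_left)
  also have "(\<Sum>G\<in>\<G>. \<Sum>D\<in>\<D>. real (card {e \<in> T. e + mat_prod k D G \<in> T}))
    = (\<Sum>D\<in>\<D>. \<Sum>G\<in>\<G>. real (card {e \<in> T. e + mat_prod k D G \<in> T}))" by (rule sum.swap)
  also have "\<dots> = (\<Sum>D\<in>\<D>. real (card T) * (N (lin_span k D) * (real (CARD('a) ^ k) / card (lin_span k D)) ^ n))"
  proof (rule sum.cong[OF refl])
    fix D assume D: "D \<in> \<D>"
    have U: "lin_span k D \<subseteq> coords t" using D lin_span_coords unfolding \<D>_def by blast
    have "(\<Sum>G\<in>\<G>. real (card {e \<in> T. e + mat_prod k D G \<in> T})) = (\<Sum>G\<in>\<G>. \<Sum>e\<in>T. of_bool (e + mat_prod k D G \<in> T))"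
      by (simp only: sum_of_bool_card[OF finT])
    also have "\<dots> = (\<Sum>e\<in>T. \<Sum>G\<in>\<G>. of_bool (e + mat_prod k D G \<in> T))" by (rule sum.swap)
    also have "\<dots> = (\<Sum>e\<in>T. N (lin_span k D) * (real (CARD('a) ^ k) / card (lin_span k D)) ^ n)"
    proof (rule sum.cong[OF refl])
      fix e assume e: "e \<in> T"
      show "(\<Sum>G\<in>\<G>. of_bool (e + mat_prod k D G \<in> T)) = N (lin_span k D) * (real (CARD('a) ^ k) / card
          (lin_span k D)) ^ n"
        unfolding sum_of_bool_card[OF fin(1)]
        using card_solutions[OF finT T e, where k = k and D = D] N[OF subspace_lin_span U e]
        by (simp only: \<G>_def)
    qed
    finally show "(\<Sum>G\<in>\<G>. real (card {e \<in> T. e + mat_prod k D G \<in> T}))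
      = real (card T) * (N (lin_span k D) * (real (CARD('a) ^ k) / card (lin_span k D)) ^ n)" by simp
  qed
  also have "\<dots> = real (card T) * (\<Sum>D\<in>\<D>. N (lin_span k D) * (real (CARD('a) ^ k) / card (lin_span k D)) ^ n)"
    by (simp add: sum_distrib_left)
  finally show ?thesis .
qed

lemma half_covered:
  fixes T :: "(nat \<Rightarrow> nat \<Rightarrow> 'a::{field,finite}) set" and k n t :: nat
  assumes T: "T \<subseteq> tuples n (\<lambda>_. coords t)" "T \<noteq> {}"
    and N: "\<And>U e. fun_vs.subspace U \<Longrightarrow> U \<subseteq> coords t \<Longrightarrow> e \<in> T \<Longrightarrow> real (card {e' \<in> T. e' - e \<in> tuples n (\<lambda>_.
        U)}) = N U"
  defines "\<G> \<equiv> tuples n (\<lambda>_. coords k :: (nat \<Rightarrow> 'a) set)" and "\<D> \<equiv> tuples k (\<lambda>_. coords t :: (nat \<Rightarrow> 'a) set)"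
    and "W \<equiv> tuples n (\<lambda>_. coords t :: (nat \<Rightarrow> 'a) set)"
  assumes S: "(\<Sum>D\<in>\<D>. N (lin_span k D) / real (card (lin_span k D)) ^ n) * card W \<le> 2 * (real (card \<D>) * card T)"
  shows "\<exists>G\<in>\<G>. 2 * card {u \<in> W. \<forall>A\<in>\<D>. mat_prod k A G + u \<notin> T} \<le> card W"
  \<comment> \<open>Cauchy--Schwarz: the number of pairs \<open>(G, u)\<close> with a solution is at least
    (first moment)\<open>\<^sup>2\<close> / (second moment).\<close>
proof (rule ccontr)
  assume neg: "\<not> ?thesis"
  have fin: "finite \<G>" "finite \<D>" "finite W" unfolding \<G>_def \<D>_def W_def by (intro finite_tuples finite_coords)+
  have finT: "finite T" using T fin by (auto simp: W_def intro: finite_subset)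
  have "0 \<in> \<G>" "0 \<in> \<D>" "0 \<in> W" by (auto simp: \<G>_def \<D>_def W_def tuples_def)
  hence pos: "card \<G> > 0" "card \<D> > 0" "card W > 0" using fin by (auto simp: card_gt_0_iff)
  have posT: "card T > 0" using T finT by (simp add: card_gt_0_iff)
  define X where "X = (\<lambda>(G, u). real (card {A \<in> \<D>. mat_prod k A G + u \<in> T}))"
  define P where "P = {p \<in> \<G> \<times> W. X p \<noteq> 0}"
  have finP: "finite P" unfolding P_def using fin by auto
  have sum1: "(\<Sum>p\<in>\<G> \<times> W. X p) = real (card \<G>) * real (card \<D>) * real (card T)"
    using first_moment[OF T(1), of k] fin
    by (simp add: X_def sum.cartesian_product \<G>_def \<D>_def W_def)
  define K where "K = (\<Sum>D\<in>\<D>. N (lin_span k D) / real (card (lin_span k D)) ^ n)"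
  have cG: "real (card \<G>) = real (CARD('a) ^ k) ^ n" by (simp add: \<G>_def card_tuples card_coords)
  \<comment> \<open>The number of generator matrices is \<open>q ^ (k * n)\<close>; factoring it out
    leaves the sum bounded in the hypothesis.\<close>
  have "(\<Sum>D\<in>\<D>. N (lin_span k D) * (real (CARD('a) ^ k) / card (lin_span k D)) ^ n) = real (card \<G>) * K"
    unfolding K_def cG sum_distrib_left by (rule sum.cong) (simp_all add: power_divide)
  hence sum2: "(\<Sum>p\<in>\<G> \<times> W. (X p)\<^sup>2) = real (card \<D>) * (real (card T) * (real (card \<G>) * K))"
    using second_moment[OF T(1) N, of k] fin
    by (simp add: X_def sum.cartesian_product case_prod_beta \<G>_def \<D>_def W_def)
  have "(\<Sum>p\<in>\<G> \<times> W. X p) = (\<Sum>p\<in>P. 1 * X p)"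
    unfolding P_def using fin by (intro sum.mono_neutral_cong_right) auto
  hence "(\<Sum>p\<in>\<G> \<times> W. X p)\<^sup>2 \<le> (\<Sum>p\<in>P. 1\<^sup>2) * (\<Sum>p\<in>P. (X p)\<^sup>2)"
    using Cauchy_Schwarz_ineq_sum[of "\<lambda>_. 1" X P] by simp
  also have "\<dots> \<le> real (card P) * (\<Sum>p\<in>\<G> \<times> W. (X p)\<^sup>2)"
    using fin unfolding P_def by (simp, intro mult_left_mono sum_mono2) auto
  finally have CS: "(real (card \<G>) * real (card \<D>) * real (card T))\<^sup>2
    \<le> real (card P) * (real (card \<D>) * (real (card T) * (real (card \<G>) * K)))"
    unfolding sum1 sum2 .
  \<comment> \<open>By the assumption for contradiction every \<open>G\<close> misses more than half
    of the centres, so fewer than half of all pairs have a solution.\<close>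
  have "card P < card \<G> * card W / 2"
  proof -
    have "P = (SIGMA G:\<G>. {u \<in> W. X (G, u) \<noteq> 0})" unfolding P_def by auto
    hence "card P = (\<Sum>G\<in>\<G>. card {u \<in> W. X (G, u) \<noteq> 0})"
      using fin by (simp add: card_SigmaI)
    also have "real \<dots> = (\<Sum>G\<in>\<G>. real (card {u \<in> W. X (G, u) \<noteq> 0}))" by simp
    also have "\<dots> < (\<Sum>G\<in>\<G>. card W / 2)"
    proof (rule sum_strict_mono)
      fix G assume G: "G \<in> \<G>"
      let ?A = "{u \<in> W. \<forall>A\<in>\<D>. mat_prod k A G + u \<notin> T}"
      have "X (G, u) = 0 \<longleftrightarrow> (\<forall>A\<in>\<D>. mat_prod k A G + u \<notin> T)" for u
        using fin by (auto simp: X_def card_eq_0_iff)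
      hence "{u \<in> W. X (G, u) \<noteq> 0} = W - ?A" by auto
      hence "card {u \<in> W. X (G, u) \<noteq> 0} = card W - card ?A"
        using fin by (simp add: card_Diff_subset)
      moreover have "2 * card ?A > card W" using neg G by auto
      moreover have "card ?A \<le> card W" using fin by (intro card_mono) auto
      ultimately have "2 * card {u \<in> W. X (G, u) \<noteq> 0} < card W" by linarith
      thus "real (card {u \<in> W. X (G, u) \<noteq> 0}) < real (card W) / 2" by linarith
    qed (use fin \<open>0 \<in> \<G>\<close> in auto)
    finally show ?thesis by simp
  qed
  let ?g = "real (card \<G>)" and ?d = "real (card \<D>)" and ?T = "real (card T)" and ?w = "real (card W)"
  have p: "?g > 0" "?d > 0" "?T > 0" "?w > 0" using pos posT by auto
  have "?d * ?T * ?g * (?g * ?d * ?T) \<le> ?d * ?T * ?g * (real (card P) * K)"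
    using CS by (simp add: power2_eq_square algebra_simps)
  hence c1: "?g * ?d * ?T \<le> real (card P) * K" using p by (simp add: mult_le_cancel_left)
  \<comment> \<open>The strict comparison below multiplies by \<open>K\<close>. Positivity follows
    from \<open>c1\<close>, whose left side is positive.\<close>
  have "K > 0"
  proof (rule ccontr)
    assume "\<not> K > 0"
    hence "real (card P) * K \<le> 0" by (simp add: mult_nonneg_nonpos)
    moreover have "?g * ?d * ?T > 0" using p by simp
    ultimately show False using c1 by linarith
  qed
  hence "real (card P) * K < ?g * ?w / 2 * K" using \<open>card P < card \<G> * card W / 2\<close> by (intro
      mult_strict_right_mono) auto
  also have "\<dots> = ?g / 2 * (K * ?w)" by simp
  also have "\<dots> \<le> ?g / 2 * (2 * (?d * ?T))"
    using S unfolding K_def by (intro mult_left_mono) auto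
  finally have "real (card P) * K < ?g * ?d * ?T" by simp
  thus False using c1 by linarith
qed

text \<open>Verifies the second moment condition of \<open>half_covered\<close>. Matrices
  \<open>D\<close> are grouped by column space \<open>U\<close>. The full space supplies one unit of
  the factor 2; the hypothesis on \<open>k\<close> ensures that all proper subspaces together supply
  at most one more.\<close>

lemma subspace_sum_le:
  fixes t m z k n :: nat
  defines "V \<equiv> coords t :: (nat \<Rightarrow> 'a::{field,finite}) set"
  defines "M \<equiv> column_mset m z V"
  defines "\<D> \<equiv> tuples k (\<lambda>_. V)"
  defines "\<tau> \<equiv> real (card (permutations_of_multiset M)) powr (1 / t)"
  assumes t: "t \<ge> 1" and k: "real (CARD('a)) ^ n * 2 ^ (CARD('a) ^ t) \<le> real (CARD('a)) ^ k * \<tau>"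
  shows "(\<Sum>D\<in>\<D>. real (card (permutations_of_multiset M))
        / real (card (permutations_of_multiset (image_mset (\<lambda>v. {x. x - v \<in> lin_span k D}) M)))
        / real (card (lin_span k D)) ^ n) * real (card V) ^ n
    \<le> 2 * (real (card V) ^ k * real (card (permutations_of_multiset M)))"
proof -
  let ?q = "real CARD('a)" and ?T = "real (card (permutations_of_multiset M))"
  define P where "P = (\<lambda>U. real (card (permutations_of_multiset (image_mset (\<lambda>v. {x. x - v \<in> U}) M))))"
  define \<U> where "\<U> = {U. fun_vs.subspace U \<and> U \<subseteq> V}"
  \<comment> \<open>The factor lost per unit of codimension. The hypothesis on \<open>k\<close> says
    that it is at most the reciprocal of the crude bound \<open>cU\<close>, which counts all subsets
    of \<open>V\<close>.\<close>
  define \<theta> where "\<theta> = ?q ^ n / (?q ^ k * \<tau>)"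
  have finV: "finite V" unfolding V_def by (rule finite_coords)
  have fin: "finite \<D>" unfolding \<D>_def using finV by (intro finite_tuples)
  have finU: "finite \<U>" unfolding \<U>_def using finV by (rule_tac finite_subset[of _ "Pow V"]) auto
  have cV: "card V = CARD('a) ^ t" unfolding V_def by (rule card_coords)
  have cU: "card \<U> \<le> 2 ^ (CARD('a) ^ t)"
  proof -
    have "card \<U> \<le> card (Pow V)" unfolding \<U>_def using finV by (intro card_mono) auto
    thus ?thesis using finV by (simp add: card_Pow cV)
  qed
  have q1: "?q \<ge> 2"
  proof -
    have "card {0::'a, 1} \<le> CARD('a)" by (intro card_mono) auto
    thus ?thesis by simp
  qed
  have posT: "?T > 0" by (simp add: card_gt_0_iff)
  hence tau: "\<tau> > 0" by (simp add: \<tau>_def)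
  have theta0: "\<theta> > 0" using tau q1 by (simp add: \<theta>_def)
  have theta: "\<theta> * 2 ^ (CARD('a) ^ t) \<le> 1" using k tau q1 by (simp add: \<theta>_def field_simps)
  have theta1: "\<theta> \<le> 1"
  proof -
    have "\<theta> * 1 \<le> \<theta> * 2 ^ (CARD('a) ^ t)" using theta0 by (intro mult_left_mono) auto
    thus ?thesis using theta by simp
  qed
  \<comment> \<open>Compared with \<open>U = V\<close>, codimension \<open>s\<close> divides the
    bound on the number of families \<open>D\<close> by \<open>q ^ (s * k)\<close>, multiplies the
    weight by \<open>q ^ (s * n)\<close>, and divides by \<open>P U\<close>, which is at least
    \<open>\<tau> ^ s\<close>. The net factor is at most \<open>\<theta> ^ s\<close>.\<close>
  have term_le: "real (card U) ^ k * (?T / P U / real (card U) ^ n) * real (card V) ^ n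
      \<le> real (card V) ^ k * ?T * (if U = V then 1 else \<theta>)" if U: "U \<in> \<U>" for U
  proof -
    have sub: "fun_vs.subspace U" "U \<subseteq> V" using U by (auto simp: \<U>_def)
    have finU: "finite U" using sub finV finite_subset by blast
    obtain d where d: "card U = CARD('a) ^ d" using card_fun_subspace[OF sub(1) finU] by blast
    have "?q ^ d \<le> ?q ^ t" using card_mono[OF finV sub(2)] unfolding d cV by (metis of_nat_le_iff of_nat_power)
    hence dt: "d \<le> t" using q1 by (simp add: power_le_imp_le_exp)
    define s where "s = t - d"
    have ts: "t = d + s" "d = t - s" "s \<le> t" using dt by (auto simp: s_def)
    have "P U = shadow_card TYPE('a) t m z s"
      unfolding P_def M_def V_def of_nat_eq_iff
    proof (rule card_quotient_permutations)
      show "card U = CARD('a) ^ (t - s)" using d ts(2) by simp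
    qed (use sub ts(3) in \<open>simp_all add: V_def\<close>)
    moreover have "\<tau> ^ s \<le> real (shadow_card TYPE('a) t m z s)"
      using shadow_card_ge[OF t ts(3), where 'a = 'a and m = m and z = z]
      unfolding shadow_card_full \<tau>_def M_def V_def by simp
    ultimately have PU: "P U \<ge> \<tau> ^ s" by simp
    have P0: "P U > 0" using PU tau by (meson less_le_trans zero_less_power)
    have e: "real (card V) ^ j = real (card U) ^ j * (?q ^ s) ^ j" for j
      unfolding cV d using ts(1) by (simp add: power_add power_mult_distrib)
    have u: "real (card U) > 0" using d q1 by simp
    have "real (card U) ^ k * (?T / P U / real (card U) ^ n) * real (card V) ^ n
        = real (card U) ^ k * ?T * (?q ^ s) ^ n / P U"
      unfolding e[of n] using u by (simp add: field_simps)
    also have "\<dots> \<le> real (card U) ^ k * ?T * (?q ^ s) ^ n / \<tau> ^ s"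
      using PU P0 tau posT u by (intro divide_left_mono) (auto intro!: mult_pos_pos)
    also have "\<dots> = real (card V) ^ k * ?T * \<theta> ^ s"
      unfolding e[of k] using q1 tau
      by (simp add: \<theta>_def field_simps power_mult_distrib flip: power_mult)
    also have "\<dots> \<le> real (card V) ^ k * ?T * (if U = V then 1 else \<theta>)"
    proof (intro mult_left_mono)
      show "\<theta> ^ s \<le> (if U = V then 1 else \<theta>)"
      proof (cases "U = V")
        case True
        thus ?thesis using theta0 theta1 by (simp add: power_le_one)
      next
        case False
        have "s \<noteq> 0"
        proof
          assume "s = 0"
          hence "card U = card V" using d cV ts(1) by simp
          thus False using False card_subset_eq[OF finV sub(2)] by simp
        qed
        hence "\<theta> ^ s \<le> \<theta> ^ 1" using theta0 theta1 by (intro power_decreasing) auto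
        thus ?thesis using False by simp
      qed
    qed (use posT in auto)
    finally show ?thesis .
  qed
  \<comment> \<open>A family with span \<open>U\<close> has all its \<open>k\<close> members in
    \<open>U\<close>.\<close>
  have count: "card {D \<in> \<D>. lin_span k D = U} \<le> card U ^ k" if "U \<in> \<U>" for U
  proof -
    have fU: "finite U" using that finV finite_subset by (auto simp: \<U>_def)
    have "{D \<in> \<D>. lin_span k D = U} \<subseteq> tuples k (\<lambda>_. U)"
    proof
      fix D assume "D \<in> {D \<in> \<D>. lin_span k D = U}"
      thus "D \<in> tuples k (\<lambda>_. U)" using generator_in_lin_span[of _ k D] by (auto simp: \<D>_def tuples_def)
    qed
    hence "card {D \<in> \<D>. lin_span k D = U} \<le> card (tuples k (\<lambda>_. U))"
      using fU by (intro card_mono finite_tuples)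
    thus ?thesis by (simp add: card_tuples)
  qed
  let ?h = "\<lambda>U. ?T / P U / real (card U) ^ n"
  have im: "lin_span k ` \<D> \<subseteq> \<U>"
    using subspace_lin_span lin_span_coords unfolding \<U>_def \<D>_def V_def by blast
  have "(\<Sum>D\<in>\<D>. ?h (lin_span k D)) = (\<Sum>U\<in>\<U>. \<Sum>D\<in>{D \<in> \<D>. lin_span k D = U}. ?h (lin_span k D))"
    by (rule sum.group[OF fin finU im, symmetric])
  also have "\<dots> = (\<Sum>U\<in>\<U>. real (card {D \<in> \<D>. lin_span k D = U}) * ?h U)"
    by (rule sum.cong[OF refl]) simp
  also have "\<dots> \<le> (\<Sum>U\<in>\<U>. real (card U) ^ k * ?h U)"
  proof (intro sum_mono mult_right_mono)
    fix U assume "U \<in> \<U>"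
    from count[OF this] have "real (card {D \<in> \<D>. lin_span k D = U}) \<le> real (card U ^ k)"
      by (simp only: of_nat_le_iff)
    thus "real (card {D \<in> \<D>. lin_span k D = U}) \<le> real (card U) ^ k" by (simp only: of_nat_power)
  qed (simp add: P_def)
  finally have "(\<Sum>D\<in>\<D>. ?h (lin_span k D)) * real (card V) ^ n \<le> (\<Sum>U\<in>\<U>. real (card U) ^ k * ?h U) * real
      (card V) ^ n"
    by (rule mult_right_mono) simp
  also have "\<dots> = (\<Sum>U\<in>\<U>. real (card U) ^ k * ?h U * real (card V) ^ n)" by (simp only: sum_distrib_right)
  also have "\<dots> \<le> (\<Sum>U\<in>\<U>. real (card V) ^ k * ?T * (if U = V then 1 else \<theta>))"
    by (rule sum_mono) (rule term_le)
  also have "\<dots> = real (card V) ^ k * ?T * (\<Sum>U\<in>\<U>. if U = V then 1 else \<theta>)" by (simp only: sum_distrib_left)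
  also have "\<dots> \<le> real (card V) ^ k * ?T * 2"
  proof (rule mult_left_mono)
    have "(\<Sum>U\<in>\<U>. if U = V then 1 else \<theta>) \<le> (\<Sum>U\<in>\<U>. (if U = V then 1 else 0) + \<theta>)"
      using theta0 by (intro sum_mono) auto
    also have "\<dots> \<le> 1 + real (card \<U>) * \<theta>" using finU by (simp add: sum.distrib)
    also have "real (card \<U>) * \<theta> \<le> 2 ^ (CARD('a) ^ t) * \<theta>"
    proof (rule mult_right_mono)
      have "real (card \<U>) \<le> real (2 ^ (CARD('a) ^ t))" using cU by (simp only: of_nat_le_iff)
      thus "real (card \<U>) \<le> 2 ^ (CARD('a) ^ t)" by simp
    qed (use theta0 in simp)
    finally show "(\<Sum>U\<in>\<U>. if U = V then 1 else \<theta>) \<le> 2" using theta by (simp add: mult.commute)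
  qed (use posT in simp)
  finally show ?thesis unfolding P_def by (simp only: mult_ac)
qed

section \<open>From half covering to covering\<close>

text \<open>The counterpart of \<open>code_power\<close> for matrices stored by columns.\<close>

definition rows_power :: "nat \<Rightarrow> nat \<Rightarrow> (nat \<Rightarrow> 'a::zero) set \<Rightarrow> (nat \<Rightarrow> nat \<Rightarrow> 'a) set" where
  "rows_power t n C = {c \<in> tuples n (\<lambda>_. coords t). \<forall>i<t. (\<lambda>j. c j i) \<in> C}"

text \<open>Covering is expressed with \<open>c + u\<close>; the passage to the distance, which uses
  \<open>c - u\<close>, replaces the centre by its negative.\<close>

definition uncovered :: "nat \<Rightarrow> nat \<Rightarrow> (nat \<Rightarrow> nat \<Rightarrow> 'a::ab_group_add) set \<Rightarrow> (nat \<Rightarrow> 'a) set \<Rightarrow> (nat \<Rightarrow> nat \<Rightarrow>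
    'a) set" where
  "uncovered t n T C = {u \<in> tuples n (\<lambda>_. coords t). \<forall>c\<in>rows_power t n C. c + u \<notin> T}"

lemma transpose_tuples:
  "G \<in> tuples n (\<lambda>_. coords k) \<Longrightarrow> (\<lambda>i j. G j i) \<in> tuples k (\<lambda>_. coords n)"
  by (auto simp: tuples_def fun_eq_iff) (metis not_less)

text \<open>Transposed view: the rows of \<open>A G\<close> are combinations of the rows of
  \<open>G\<close>, so the code is the row space of \<open>G\<close>.\<close>

lemma mat_prod_rows_power:
  fixes G :: "nat \<Rightarrow> nat \<Rightarrow> 'a::comm_ring"
  assumes "A \<in> tuples k (\<lambda>_. coords t)" "G \<in> tuples n (\<lambda>_. coords k)"
  shows "mat_prod k A G \<in> rows_power t n (lin_span k (\<lambda>i j. G j i))"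
proof -
  have "(\<lambda>j. mat_prod k A G j r) \<in> lin_span k (\<lambda>i j. G j i)" for r
  proof -
    have "(\<lambda>j. mat_prod k A G j r) = lin_comb k (\<lambda>i j. G j i) (\<lambda>i. A i r)"
      by (simp add: mat_prod_def lin_comb_def mult.commute)
    moreover have "(\<lambda>i. A i r) \<in> coords k" using assms(1) by (auto simp: tuples_def)
    ultimately show ?thesis unfolding lin_span_def by blast
  qed
  thus ?thesis using mat_prod_tuples[OF assms] by (simp add: rows_power_def)
qed

lemma card_lin_span_le: "card (lin_span k (D :: nat \<Rightarrow> nat \<Rightarrow> 'a::{field,finite})) \<le> CARD('a) ^ k"
  unfolding lin_span_def using card_image_le[OF finite_coords, of "lin_comb k D" k] by (simp add: card_coords)

text \<open>Averaging over all translates.\<close>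

lemma exists_small_intersection:
  fixes N W :: "'b::ab_group_add set"
  assumes W: "finite W" "W \<noteq> {}" "\<And>x y. x \<in> W \<Longrightarrow> y \<in> W \<Longrightarrow> x - y \<in> W" and N: "N \<subseteq> W"
  shows "\<exists>w\<in>W. card {u \<in> N. w + u \<in> N} * card W \<le> card N ^ 2"
proof (rule ccontr)
  assume "\<not> ?thesis"
  hence less: "card N ^ 2 < card {u \<in> N. w + u \<in> N} * card W" if "w \<in> W" for w using that by (auto simp: not_le)
  have finN: "finite N" using N W finite_subset by blast
  have c: "card {w \<in> W. w + u \<in> N} = card N" if "u \<in> N" for u
  proof -
    have "bij_betw (\<lambda>w. w + u) {w \<in> W. w + u \<in> N} N"
      using N W that by (intro bij_betw_byWitness[where f' = "\<lambda>e. e - u"]) auto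
    thus ?thesis by (rule bij_betw_same_card)
  qed
  have "(\<Sum>w\<in>W. card {u \<in> N. w + u \<in> N}) = (\<Sum>w\<in>W. \<Sum>u\<in>N. if w + u \<in> N then 1 else 0)"
    using finN by (simp add: sum.If_cases Int_def)
  also have "\<dots> = (\<Sum>u\<in>N. \<Sum>w\<in>W. if w + u \<in> N then 1 else 0)" by (rule sum.swap)
  also have "\<dots> = (\<Sum>u\<in>N. card {w \<in> W. w + u \<in> N})"
    using W by (simp add: sum.If_cases Int_def)
  also have "\<dots> = card N ^ 2" using c by (simp add: power2_eq_square)
  finally have eq: "(\<Sum>w\<in>W. card {u \<in> N. w + u \<in> N}) = card N ^ 2" .
  have "(\<Sum>w\<in>W. card N ^ 2) < (\<Sum>w\<in>W. card {u \<in> N. w + u \<in> N} * card W)"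
    using W less by (intro sum_strict_mono) auto
  thus False unfolding sum_distrib_right[symmetric] eq by (simp add: mult.commute)
qed

text \<open>Choose \<open>w\<close> such that \<open>u\<close> and \<open>w + u\<close> are rarely
  both uncovered, and adjoin the rows of \<open>w\<close> to \<open>C\<close>. The matrices over the
  new code contain those over \<open>C\<close> together with their translates by \<open>w\<close>.
  Hence a centre left uncovered was uncovered before, and so was its translate by
  \<open>w\<close>.\<close>

lemma extend_code:
  fixes C :: "(nat \<Rightarrow> 'a::{field,finite}) set" and T :: "(nat \<Rightarrow> nat \<Rightarrow> 'a) set"
  assumes C: "fun_vs.subspace C" "C \<subseteq> coords n"
  shows "\<exists>C'. fun_vs.subspace C' \<and> C' \<subseteq> coords n \<and> card C' \<le> card C * CARD('a) ^ t
    \<and> card (uncovered t n T C') * card (tuples n (\<lambda>_. coords t :: (nat \<Rightarrow> 'a) set)) \<le> card (uncovered t n T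
        C) ^ 2"
proof -
  let ?W = "tuples n (\<lambda>_. coords t :: (nat \<Rightarrow> 'a) set)"
  have finW: "finite ?W" by (intro finite_tuples finite_coords)
  have "0 \<in> ?W" by (auto simp: tuples_def)
  hence "\<exists>w\<in>?W. card {u \<in> uncovered t n T C. w + u \<in> uncovered t n T C} * card ?W \<le> card (uncovered t n T
      C) ^ 2"
    using finW tuples_coords_diff by (intro exists_small_intersection) (auto simp: uncovered_def)
  then obtain w where w: "w \<in> ?W" "card {u \<in> uncovered t n T C. w + u \<in> uncovered t n T C} * card ?W \<le>
      card (uncovered t n T C) ^ 2"
    by blast
  define L where "L = lin_span t (\<lambda>i j. w j i)"
  define C' where "C' = {x + y | x y. x \<in> C \<and> y \<in> L}"
  have L: "fun_vs.subspace L" "L \<subseteq> coords n" unfolding L_def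
    using subspace_lin_span lin_span_coords[OF transpose_tuples[OF w(1)]] by blast+
  have sub: "fun_vs.subspace C'" unfolding C'_def by (rule fun_vs.subspace_sums[OF C(1) L(1)])
  have coords: "C' \<subseteq> coords n" using C(2) L(2) by (fastforce simp: C'_def tuples_def)
  have finC: "finite C" using C(2) finite_coords finite_subset by blast
  have "C' = (\<lambda>(x, y). x + y) ` (C \<times> L)" by (auto simp: C'_def)
  hence "card C' \<le> card (C \<times> L)" using finC finite_lin_span by (auto simp: L_def intro!: card_image_le)
  also have "\<dots> \<le> card C * CARD('a) ^ t" unfolding card_cartesian_product L_def by (rule mult_le_mono2[OF
      card_lin_span_le])
  finally have card: "card C' \<le> card C * CARD('a) ^ t" .
  have c1: "c \<in> rows_power t n C'" if "c \<in> rows_power t n C" for c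
  proof -
    have "x \<in> C'" if "x \<in> C" for x
    proof -
      have "x = x + 0" by simp
      thus ?thesis unfolding C'_def using that fun_vs.subspace_0[OF L(1)] by blast
    qed
    thus ?thesis using that by (auto simp: rows_power_def)
  qed
  have c2: "c + w \<in> rows_power t n C'" if c: "c \<in> rows_power t n C" for c
  proof -
    have "(\<lambda>j. (c + w) j i) \<in> C'" if "i < t" for i
    proof -
      have "(\<lambda>j. (c + w) j i) = (\<lambda>j. c j i) + (\<lambda>j. w j i)" by (simp add: fun_eq_iff)
      moreover have "(\<lambda>j. w j i) \<in> L" unfolding L_def using generator_in_lin_span[OF that, of "\<lambda>i j. w j
          i"] by simp
      moreover have "(\<lambda>j. c j i) \<in> C" using c that by (simp add: rows_power_def)
      ultimately show ?thesis unfolding C'_def by blast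
    qed
    thus ?thesis using c w(1) tuples_coords_add by (auto simp: rows_power_def)
  qed
  have "uncovered t n T C' \<subseteq> {u \<in> uncovered t n T C. w + u \<in> uncovered t n T C}"
  proof
    fix u assume u: "u \<in> uncovered t n T C'"
    have uW: "u \<in> ?W" using u by (simp add: uncovered_def)
    have "u \<in> uncovered t n T C" using u c1 by (auto simp: uncovered_def)
    moreover have "c + (w + u) \<notin> T" if "c \<in> rows_power t n C" for c
      using u c2[OF that] by (auto simp: uncovered_def add.assoc)
    hence "w + u \<in> uncovered t n T C" using tuples_coords_add[OF w(1) uW] by (simp add: uncovered_def)
    ultimately show "u \<in> {u \<in> uncovered t n T C. w + u \<in> uncovered t n T C}" by simp
  qed
  moreover have "finite {u \<in> uncovered t n T C. w + u \<in> uncovered t n T C}"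
    using finW by (rule rev_finite_subset) (auto simp: uncovered_def)
  ultimately have "card (uncovered t n T C') \<le> card {u \<in> uncovered t n T C. w + u \<in> uncovered t n T C}"
    by (intro card_mono)
  hence "card (uncovered t n T C') * card ?W \<le> card (uncovered t n T C) ^ 2"
    using w(2) by (meson le_trans mult_le_mono1)
  thus ?thesis using sub coords card by blast
qed

text \<open>Each round adds at most \<open>t\<close> dimensions and squares the uncovered fraction,
  which starts at no more than 1/2.\<close>

lemma iterate_extend_code:
  fixes C :: "(nat \<Rightarrow> 'a::{field,finite}) set" and T :: "(nat \<Rightarrow> nat \<Rightarrow> 'a) set"
  assumes C: "fun_vs.subspace C" "C \<subseteq> coords n" "card C \<le> CARD('a) ^ k"
    and half: "2 * card (uncovered t n T C) \<le> card (tuples n (\<lambda>_. coords t :: (nat \<Rightarrow> 'a) set))"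
  shows "\<exists>C'. fun_vs.subspace C' \<and> C' \<subseteq> coords n \<and> card C' \<le> CARD('a) ^ (k + t * i)
    \<and> 2 ^ (2 ^ i) * card (uncovered t n T C') \<le> card (tuples n (\<lambda>_. coords t :: (nat \<Rightarrow> 'a) set))"
proof (induction i)
  case 0
  show ?case using C half by (intro exI[of _ C]) simp
next
  case (Suc i)
  let ?w = "card (tuples n (\<lambda>_. coords t :: (nat \<Rightarrow> 'a) set))"
  from Suc obtain C1 where C1: "fun_vs.subspace C1" "C1 \<subseteq> coords n" "card C1 \<le> CARD('a) ^ (k + t * i)"
    "2 ^ (2 ^ i) * card (uncovered t n T C1) \<le> ?w" by blast
  obtain C2 where C2: "fun_vs.subspace C2" "C2 \<subseteq> coords n" "card C2 \<le> card C1 * CARD('a) ^ t"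
    "card (uncovered t n T C2) * ?w \<le> card (uncovered t n T C1) ^ 2"
    using extend_code[OF C1(1,2), of t T] by blast
  have "card C2 \<le> CARD('a) ^ (k + t * i) * CARD('a) ^ t"
    using C2(3) mult_le_mono1[OF C1(3)] by (rule order_trans)
  hence c: "card C2 \<le> CARD('a) ^ (k + t * Suc i)" by (simp add: power_add mult.commute mult.left_commute)
  have pow: "(2::nat) ^ (2 ^ Suc i) = (2 ^ (2 ^ i)) ^ 2" by (simp flip: power_mult)
  have "2 ^ (2 ^ Suc i) * card (uncovered t n T C2) * ?w \<le> (2 ^ (2 ^ i) * card (uncovered t n T C1)) ^ 2"
    unfolding pow power_mult_distrib mult.assoc by (rule mult_le_mono2[OF C2(4)])
  also have "\<dots> \<le> ?w ^ 2" using C1(4) by (rule power_mono) simp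
  finally have "2 ^ (2 ^ Suc i) * card (uncovered t n T C2) * ?w \<le> ?w * ?w" by (simp only: power2_eq_square)
  moreover have "?w > 0" by (simp add: card_tuples card_coords)
  ultimately have "2 ^ (2 ^ Suc i) * card (uncovered t n T C2) \<le> ?w" by simp
  thus ?case using C2 c by blast
qed

text \<open>The hypothesis on \<open>k\<close> yields a code that covers half of the matrices. The
  one on \<open>i\<close> makes \<open>2 ^ (2 ^ i)\<close> exceed the number of all matrices, so
  after \<open>i\<close> rounds fewer than one centre is uncovered.\<close>

lemma exists_covering_subspace:
  fixes t m z k n i :: nat
  defines "M \<equiv> column_mset m z (coords t :: (nat \<Rightarrow> 'a::{field,finite}) set)"
  assumes t: "t \<ge> 1" and n: "n = (CARD('a) ^ t - 1) * m + z"
    and k: "real (CARD('a)) ^ n * 2 ^ (CARD('a) ^ t) \<le> real (CARD('a)) ^ k * real (card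
        (permutations_of_multiset M)) powr (1 / t)"
    and i: "CARD('a) ^ (t * n) < 2 ^ (2 ^ i)"
  shows "\<exists>C. fun_vs.subspace C \<and> C \<subseteq> coords n \<and> card C \<le> CARD('a) ^ (k + t * i)
    \<and> (\<forall>u\<in>tuples n (\<lambda>_. coords t). \<exists>c\<in>rows_power t n C. c + u \<in> words n M)"
proof -
  let ?V = "coords t :: (nat \<Rightarrow> 'a) set"
  let ?W = "tuples n (\<lambda>_. ?V)" and ?T = "words n M"
  let ?P = "\<lambda>U. real (card (permutations_of_multiset (image_mset (\<lambda>v. {x. x - v \<in> U}) M)))"
  have size: "size M = n" unfolding M_def n by (subst size_column_mset) (auto simp: finite_coords
      zero_coords card_coords)
  have setM: "set_mset M \<subseteq> ?V"
    using zero_coords[of t] by (auto simp: M_def count_column_mset finite_coords split: if_splits simp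
        flip: count_greater_zero_iff)
  have TW: "?T \<subseteq> ?W" using setM by (auto simp: words_def tuples_def)
  have Tne: "?T \<noteq> {}"
  proof -
    have "card ?T > 0" unfolding card_words[OF size] by (simp add: card_gt_0_iff)
    thus ?thesis by auto
  qed
  have cW: "card ?W = card ?V ^ n" by (simp add: card_tuples)
  have finW: "finite ?W" by (intro finite_tuples finite_coords)
  have "\<exists>G\<in>tuples n (\<lambda>_. coords k). 2 * card {u \<in> ?W. \<forall>A\<in>tuples k (\<lambda>_. ?V). mat_prod k A G + u \<notin> ?T} \<le> card ?W"
  proof (rule half_covered[OF TW Tne])
    fix U :: "(nat \<Rightarrow> 'a) set" and e assume U: "fun_vs.subspace U" and e: "e \<in> ?T"
    \<comment> \<open>Words congruent to \<open>e\<close> modulo \<open>U\<close> form one fibre of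
      the reduction, so \<open>N U\<close> is the number of words divided by the number of reduced
      words.\<close>
    have "real (card {e' \<in> ?T. e' - e \<in> tuples n (\<lambda>_. U)}) * ?P U = real (card (permutations_of_multiset M))"
      using card_words_fibre[OF size U e] card_words[OF size] by (simp only: of_nat_mult[symmetric])
    moreover have "?P U \<noteq> 0" by (simp add: card_eq_0_iff)
    ultimately show "real (card {e' \<in> ?T. e' - e \<in> tuples n (\<lambda>_. U)}) = real (card
        (permutations_of_multiset M)) / ?P U"
      by (rule nonzero_eq_divide_eq[THEN iffD2, rotated])
  next
    show "(\<Sum>D\<in>tuples k (\<lambda>_. ?V). real (card (permutations_of_multiset M)) / ?P (lin_span k D) / real (card
        (lin_span k D)) ^ n) * real (card ?W)
      \<le> 2 * (real (card (tuples k (\<lambda>_. ?V))) * real (card ?T))"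
      using subspace_sum_le[OF t, where 'a = 'a and n = n and k = k and m = m and z = z] k
      unfolding card_words[OF size] M_def[symmetric] cW by (simp add: card_tuples M_def)
  qed
  then obtain G where G: "G \<in> tuples n (\<lambda>_. coords k)"
    "2 * card {u \<in> ?W. \<forall>A\<in>tuples k (\<lambda>_. ?V). mat_prod k A G + u \<notin> ?T} \<le> card ?W" by blast
  define C where "C = lin_span k (\<lambda>i j. G j i)"
  have "uncovered t n ?T C \<subseteq> {u \<in> ?W. \<forall>A\<in>tuples k (\<lambda>_. ?V). mat_prod k A G + u \<notin> ?T}"
    using mat_prod_rows_power[OF _ G(1)] unfolding uncovered_def C_def by blast
  hence "card (uncovered t n ?T C) \<le> card {u \<in> ?W. \<forall>A\<in>tuples k (\<lambda>_. ?V). mat_prod k A G + u \<notin> ?T}"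
    using finW by (intro card_mono) auto
  hence half: "2 * card (uncovered t n ?T C) \<le> card ?W" using G(2) by linarith
  have C: "fun_vs.subspace C" "C \<subseteq> coords n" "card C \<le> CARD('a) ^ k"
    unfolding C_def using subspace_lin_span lin_span_coords[OF transpose_tuples[OF G(1)]] card_lin_span_le
        by blast+
  obtain C' where C': "fun_vs.subspace C'" "C' \<subseteq> coords n" "card C' \<le> CARD('a) ^ (k + t * i)"
    "2 ^ (2 ^ i) * card (uncovered t n ?T C') \<le> card ?W"
    using iterate_extend_code[OF C half, of i] by blast
  have "card ?W < 2 ^ (2 ^ i)" using i by (simp add: cW card_coords flip: power_mult)
  hence "card (uncovered t n ?T C') = 0" using C'(4) by (cases "card (uncovered t n ?T C')") auto
  moreover have "finite (uncovered t n ?T C')" by (rule rev_finite_subset[OF finW]) (auto simp: uncovered_def)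
  ultimately have "uncovered t n ?T C' = {}" by simp
  hence "\<forall>u\<in>?W. \<exists>c\<in>rows_power t n C'. c + u \<in> ?T" by (auto simp: uncovered_def)
  thus ?thesis using C' by blast
qed

section \<open>Entropy asymptotics\<close>

text \<open>The term \<open>n ^ n / fact n\<close> of the exponential series at \<open>n\<close> is
  at most the whole sum.\<close>

lemma ln_fact_ge: "real n * ln n - n \<le> ln (fact n)"
proof (cases "n = 0")
  case False
  have "real n ^ n / fact n \<le> exp (real n)"
    using sum_le_suminf[OF summable_exp_generic, of "{n}" "real n"]
    by (simp add: exp_def divide_inverse mult.commute)
  hence "real n ^ n \<le> exp (real n) * fact n" by (simp add: field_simps)
  hence "ln (real n ^ n) \<le> ln (exp (real n) * fact n)" using False by (intro ln_mono) auto
  thus ?thesis using False by (simp add: ln_realpow ln_mult)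
qed simp

text \<open>The case \<open>n = 0\<close> relies on \<open>ln 0 = 0\<close>.\<close>

lemma ln_fact_le: "ln (fact n) \<le> real n * ln n - n + ln n + 1"
proof (induction n)
  case (Suc n)
  show ?case
  proof (cases "n = 0")
    case False
    hence n: "real n > 0" by simp
    \<comment> \<open>The induction step amounts to
      \<open>(n + 1) * (ln n - ln (n + 1)) \<le> -1\<close>.\<close>
    have "ln (real n / (real n + 1)) \<le> real n / (real n + 1) - 1"
      using n by (intro ln_le_minus_one) simp
    also have "\<dots> = - 1 / (real n + 1)" using n by (simp add: field_simps)
    finally have "ln (real n) - ln (real n + 1) \<le> - 1 / (real n + 1)" using n by (simp add: ln_div)
    hence "(real n + 1) * (ln (real n) - ln (real n + 1)) \<le> (real n + 1) * (- 1 / (real n + 1))"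
      using n by (intro mult_left_mono) auto
    also have "\<dots> = - 1" using n by simp
    finally have A: "(real n + 1) * (ln (real n) - ln (real n + 1)) \<le> - 1" .
    have "ln (fact (Suc n) :: real) = ln (real n + 1) + ln (fact n)"
      using n by (simp add: ln_mult add.commute)
    with Suc A show ?thesis by (simp add: algebra_simps)
  qed simp
qed simp

text \<open>Factorial estimates for a multinomial coefficient. The linear terms cancel because the
  multiplicities add up to \<open>n\<close>; each of the \<open>card V\<close> factorials in the
  denominator leaves an error of at most \<open>1 + ln n\<close>.\<close>

lemma ln_card_permutations_ge:
  fixes V :: "'b::zero set"
  assumes V: "finite V" "0 \<in> V" and n: "n = (card V - 1) * m + z" "n \<ge> 1"
  shows "n * ln n - (real (card V) - 1) * (m * ln m) - z * ln z - card V * (1 + ln n)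
    \<le> ln (card (permutations_of_multiset (column_mset m z V)))"
proof -
  let ?P = "card (permutations_of_multiset (column_mset m z V))"
  have cV: "card V \<ge> 1" using V by (simp add: Suc_le_eq card_gt_0_iff) blast
  \<comment> \<open>The unreduced count is the case of fibres of size 1.\<close>
  have "card (permutations_of_multiset (image_mset id (column_mset m z V)))
    * (fact (1 * m) ^ (card V div 1 - 1) * fact (z + (1 - 1) * m)) = fact ((card V - 1) * m + z)"
  proof (rule card_permutations_column_mset[OF V])
    fix v assume "v \<in> V"
    hence "{w \<in> V. id w = id v} = {v}" by auto
    thus "card {w \<in> V. id w = id v} = 1" by simp
  qed
  hence "?P * (fact m ^ (card V - 1) * fact z) = fact n" using n by simp
  hence "real (?P * (fact m ^ (card V - 1) * fact z)) = real (fact n)" by (simp only:)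
  hence "real ?P * (fact m ^ (card V - 1) * fact z) = fact n" by simp
  moreover have "real ?P > 0" by (simp add: card_gt_0_iff)
  ultimately have eq: "ln (real ?P) + ((real (card V) - 1) * ln (fact m) + ln (fact z)) = ln (fact n)"
    using cV ln_mult[of "real ?P" "fact m ^ (card V - 1) * fact z"]
    by (simp add: ln_mult ln_realpow of_nat_diff)
  have zn: "z \<le> n" using n by simp
  have lz: "ln (real z) \<le> ln (real n)" using zn n(2) by (cases "z = 0") auto
  \<comment> \<open>If 0 is the only letter, \<open>m\<close> is not bounded by \<open>n\<close>,
    but the coefficient vanishes.\<close>
  have lm: "(real (card V) - 1) * ln (real m) \<le> (real (card V) - 1) * ln (real n)"
  proof (cases "card V = 1")
    case False
    hence "1 * m \<le> (card V - 1) * m" using cV by (intro mult_right_mono) auto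
    hence "m \<le> n" using n(1) by linarith
    hence "ln (real m) \<le> ln (real n)" using n(2) by (cases "m = 0") auto
    thus ?thesis using cV by (intro mult_left_mono) auto
  qed simp
  have "(real (card V) - 1) * ln (fact m) \<le> (real (card V) - 1) * (m * ln m - m + ln m + 1)"
    using cV by (intro mult_left_mono ln_fact_le) auto
  moreover have "real n = (real (card V) - 1) * m + z" using n cV by (simp add: of_nat_diff)
  ultimately show ?thesis
    using eq ln_fact_le[of z] ln_fact_ge[of n] lz lm by (simp add: algebra_simps)
qed

section \<open>The entropy function and the volume of a ball\<close>

lemma entropy_ln:
  assumes "Q \<ge> 2"
  shows "entropy Q x * ln Q = x * ln (real Q - 1) - x * ln x - (1 - x) * ln (1 - x)"
  using assms by (simp add: entropy_def log_def field_simps)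

text \<open>Gibbs' inequality for the weights \<open>x\<close> and \<open>1 - x\<close> against
  \<open>(Q - 1) / Q\<close> and \<open>1 / Q\<close>. Both pairs sum to 1, so the terms without
  logarithm cancel.\<close>

lemma entropy_le_1:
  assumes Q: "Q \<ge> 2" and x: "0 \<le> x" "x < 1"
  shows "entropy Q x \<le> 1"
proof -
  have lnQ: "ln (real Q) > 0" using Q by simp
  \<comment> \<open>This is \<open>ln y \<le> y - 1\<close> at \<open>y = b / (a * Q)\<close>,
    scaled by \<open>a\<close>; it is used with \<open>b = Q - 1\<close> and
    \<open>b = 1\<close>.\<close>
  have gibbs: "a * (ln b - ln a) \<le> b / Q - a + a * ln Q" if "a \<ge> 0" "b > 0" for a b :: real
  proof (cases "a = 0")
    case False
    hence a: "a > 0" using that by simp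
    have "ln (b / (a * Q)) \<le> b / (a * Q) - 1" using that a Q by (intro ln_le_minus_one) auto
    hence "a * (ln b - ln a - ln Q) \<le> a * (b / (a * Q) - 1)"
      using that a Q by (intro mult_left_mono) (auto simp: ln_div ln_mult)
    also have "a * (b / (a * Q) - 1) = b / Q - a" using a Q by (simp add: field_simps)
    finally show ?thesis by (simp add: algebra_simps)
  qed (use that Q in auto)
  have "entropy Q x * ln Q = x * (ln (real Q - 1) - ln x) + (1 - x) * (ln 1 - ln (1 - x))"
    unfolding entropy_ln[OF Q] by (simp add: algebra_simps)
  also have "\<dots> \<le> ((real Q - 1) / Q - x + x * ln Q) + (1 / Q - (1 - x) + (1 - x) * ln Q)"
    using x Q by (intro add_mono gibbs) auto
  also have "\<dots> = ln Q" using Q by (simp add: field_simps)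
  finally show ?thesis using lnQ by simp
qed

lemma entropy_max:
  assumes Q: "Q \<ge> 2"
  shows "entropy Q (1 - 1 / Q) = 1"
proof -
  have lnQ: "ln (real Q) > 0" using Q by simp
  have l: "ln (1 - 1 / real Q) = ln (real Q - 1) - ln Q"
  proof -
    have "1 - 1 / real Q = (real Q - 1) / Q" using Q by (simp add: field_simps)
    thus ?thesis using Q by (simp add: ln_div)
  qed
  have "entropy Q (1 - 1 / Q) * ln Q = 1 * ln Q"
    unfolding entropy_ln[OF Q] l using Q by (simp add: ln_div field_simps)
  thus ?thesis using lnQ by (simp only: mult_cancel_right) simp
qed

text \<open>Exponential weighting: for \<open>0 < y \<le> 1\<close>, each
  \<open>i \<le> x * n\<close> satisfies \<open>y powr (x * n) \<le> y ^ i\<close>, and the binomial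
  theorem sums the weighted terms over all \<open>i\<close>.\<close>

lemma ball_volume_le:
  assumes Q: "Q \<ge> 2" and x: "0 \<le> x" "x \<le> 1 - 1 / real Q"
  shows "(\<Sum>i\<in>{i. i \<le> n \<and> real i \<le> x * n}. real (n choose i) * (real Q - 1) ^ i) \<le> real Q powr (n * entropy Q x)"
proof (cases "x = 0")
  case True
  hence "{i. i \<le> n \<and> real i \<le> x * n} = {0}" by auto
  thus ?thesis using True Q by (simp add: entropy_def)
next
  case False
  have Q1: "real Q - 1 > 0" using Q by simp
  have x0: "x > 0" using False x by simp
  have "1 / real Q > 0" using Q by simp
  hence x1: "x < 1" using x by linarith
  \<comment> \<open>The minimiser of \<open>((Q - 1) * y + 1) / y powr x\<close>. It is positive
    only for \<open>x > 0\<close>, hence the separate case above, and \<open>y \<le> 1\<close> is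
    exactly the assumption \<open>x \<le> 1 - 1 / Q\<close>.\<close>
  define y where "y = x / ((real Q - 1) * (1 - x))"
  have y0: "y > 0" using Q1 x0 x1 by (simp add: y_def)
  have y1: "y \<le> 1"
  proof -
    have "x * Q \<le> (1 - 1 / real Q) * Q" using x by (intro mult_right_mono) auto
    also have "(1 - 1 / real Q) * Q = Q - 1" using Q by (simp add: algebra_simps)
    finally have "x * Q \<le> real Q - 1" using Q by (simp add: of_nat_diff)
    hence "x \<le> (real Q - 1) * (1 - x)" by (simp add: algebra_simps)
    thus ?thesis using Q1 x1 by (simp add: y_def)
  qed
  have lny: "ln y = ln x - ln (real Q - 1) - ln (1 - x)"
    using Q1 x0 x1 by (simp add: y_def ln_div ln_mult)
  let ?S = "{i. i \<le> n \<and> real i \<le> x * n}"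
  have "(\<Sum>i\<in>?S. real (n choose i) * (real Q - 1) ^ i) * y powr (x * n)
    = (\<Sum>i\<in>?S. real (n choose i) * (real Q - 1) ^ i * y powr (x * n))" by (rule sum_distrib_right)
  also have "\<dots> \<le> (\<Sum>i\<in>?S. real (n choose i) * (real Q - 1) ^ i * y ^ i)"
  proof (intro sum_mono mult_left_mono)
    fix i assume "i \<in> ?S"
    hence "y powr (x * n) \<le> y powr (real i)" using y0 y1 by (intro powr_mono') auto
    thus "y powr (x * n) \<le> y ^ i" using y0 by (simp add: powr_realpow)
  qed (use Q1 in auto)
  also have "\<dots> \<le> (\<Sum>i\<le>n. real (n choose i) * (real Q - 1) ^ i * y ^ i)"
    using Q1 y0 by (intro sum_mono2) auto
  also have "\<dots> = ((real Q - 1) * y + 1) ^ n"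
    unfolding binomial_ring by (intro sum.cong) (auto simp: power_mult_distrib)
  also have "(real Q - 1) * y = x / (1 - x)" using Q1 by (simp add: y_def)
  also have "x / (1 - x) + 1 = 1 / (1 - x)" using x1 by (simp add: field_simps)
  also have "(1 / (1 - x)) ^ n = exp (- real n * ln (1 - x))"
  proof -
    have "exp (- real n * ln (1 - x)) = exp (real n * ln (1 / (1 - x)))" using x1 by (simp add: ln_div)
    also have "\<dots> = (1 / (1 - x)) ^ n" using x1 by (simp only: exp_of_nat_mult) simp
    finally show ?thesis ..
  qed
  finally have "(\<Sum>i\<in>?S. real (n choose i) * (real Q - 1) ^ i) \<le> exp (- real n * ln (1 - x)) / y powr (x * n)"
    using y0 by (simp add: field_simps)
  also have "\<dots> = exp (- real n * ln (1 - x) - x * n * ln y)" using y0 by (simp add: powr_def exp_diff)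
  also have "- real n * ln (1 - x) - x * n * ln y = n * entropy Q x * ln Q"
    unfolding mult.assoc entropy_ln[OF Q] lny by (simp add: algebra_simps)
  also have "exp (n * entropy Q x * ln Q) = real Q powr (n * entropy Q x)" using Q by (simp add: powr_def)
  finally show ?thesis .
qed

section \<open>Limits of letter frequencies\<close>

lemma filterlim_real_quotient_floor:
  assumes "c \<ge> 0"
  shows "(\<lambda>n. real (nat \<lfloor>c * real n\<rfloor>) / real n) \<longlonglongrightarrow> c"
proof (rule tendsto_sandwich)
  show "\<forall>\<^sub>F n in sequentially. c - 1 / real n \<le> real (nat \<lfloor>c * real n\<rfloor>) / real n"
  proof (rule eventually_sequentiallyI[of 1])
    fix n :: nat assume "1 \<le> n"
    hence "c - 1 / real n = (c * real n - 1) / real n" by (simp add: diff_divide_distrib)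
    also have "\<dots> \<le> real (nat \<lfloor>c * real n\<rfloor>) / real n"
      by (intro divide_right_mono) linarith+
    finally show "c - 1 / real n \<le> real (nat \<lfloor>c * real n\<rfloor>) / real n" .
  qed
  show "\<forall>\<^sub>F n in sequentially. real (nat \<lfloor>c * real n\<rfloor>) / real n \<le> c"
  proof (rule eventually_sequentiallyI[of 1])
    fix n :: nat assume "1 \<le> n"
    moreover have "real (nat \<lfloor>c * real n\<rfloor>) \<le> c * real n" using assms by (simp add: of_nat_nat)
    ultimately show "real (nat \<lfloor>c * real n\<rfloor>) / real n \<le> c" by (simp add: field_simps)
  qed
  have "(\<lambda>n. c - 1 / real n) \<longlonglongrightarrow> c - 0" by (intro tendsto_intros lim_1_over_n)
  thus "(\<lambda>n. c - 1 / real n) \<longlonglongrightarrow> c" by simp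
qed simp

text \<open>Each nonzero letter gets the rounded-down share of \<open>x * n\<close> positions and 0
  gets the rest, so the weight never exceeds \<open>x * n\<close>. The limit is that of the bound in
  \<open>ln_card_permutations_ge\<close>, divided by \<open>n\<close>.\<close>

lemma entropy_limit:
  fixes m z :: "nat \<Rightarrow> nat"
  assumes Q: "Q \<ge> 2" and x: "0 \<le> x" "x < 1"
    and m_def: "\<And>n. m n = nat \<lfloor>x / (real Q - 1) * real n\<rfloor>"
    and z_def: "\<And>n. z n = n - (Q - 1) * m n"
  shows "(Q - 1) * m n \<le> n" "real ((Q - 1) * m n) \<le> x * n"
    "(\<lambda>n. (n * ln n - (real Q - 1) * (m n * ln (m n)) - z n * ln (z n) - Q * (1 + ln n)) / n)
      \<longlonglongrightarrow> entropy Q x * ln Q"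
proof -
  have Q1: "real Q - 1 > 0" using Q by simp
  have mle: "real ((Q - 1) * m n) \<le> x * n" for n
  proof -
    have "real (m n) \<le> x / (real Q - 1) * n" using x Q1 by (simp add: m_def of_nat_nat)
    hence "(real Q - 1) * m n \<le> (real Q - 1) * (x / (real Q - 1) * n)" using Q1 by (intro mult_left_mono) auto
    thus ?thesis using Q Q1 by (simp add: of_nat_diff)
  qed
  thus "real ((Q - 1) * m n) \<le> x * n" .
  have le: "(Q - 1) * m n \<le> n" for n
  proof -
    have "x * real n \<le> 1 * real n" using x by (intro mult_right_mono) auto
    hence "real ((Q - 1) * m n) \<le> real n" using mle[of n] by linarith
    thus ?thesis by (simp only: of_nat_le_iff)
  qed
  thus "(Q - 1) * m n \<le> n" .
  have zr: "real (z n) = real n - (real Q - 1) * m n" for n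
    using le[of n] Q unfolding z_def by (simp add: of_nat_diff)
  define a where "a = (\<lambda>n. real (m n) / n)"
  define b where "b = (\<lambda>n. real (z n) / n)"
  have a: "a \<longlonglongrightarrow> x / (real Q - 1)"
    unfolding a_def m_def using x Q1 by (intro filterlim_real_quotient_floor) simp
  have b: "b \<longlonglongrightarrow> 1 - x"
  proof -
    have "(\<lambda>n. 1 - (real Q - 1) * a n) \<longlonglongrightarrow> 1 - (real Q - 1) * (x / (real Q - 1))"
      by (intro tendsto_intros a)
    moreover have "\<forall>\<^sub>F n in sequentially. 1 - (real Q - 1) * a n = b n"
      by (rule eventually_sequentiallyI[of 1]) (simp add: a_def b_def zr field_simps)
    ultimately show ?thesis using Q1 by (simp add: tendsto_cong)
  qed
  \<comment> \<open>Continuity of \<open>ln\<close> fails at 0, but for \<open>x = 0\<close> all the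
    frequencies \<open>a n\<close> are 0 already.\<close>
  have al: "(\<lambda>n. a n * ln (a n)) \<longlonglongrightarrow> x / (real Q - 1) * ln (x / (real Q - 1))"
  proof (cases "x = 0")
    case True
    hence "a n = 0" for n by (simp add: a_def m_def)
    thus ?thesis using True by simp
  next
    case False
    thus ?thesis using x Q1 by (intro tendsto_intros a) auto
  qed
  have bl: "(\<lambda>n. b n * ln (b n)) \<longlonglongrightarrow> (1 - x) * ln (1 - x)"
    using x by (intro tendsto_intros b) auto
  have err: "(\<lambda>n. Q * (1 + ln n) / n) \<longlonglongrightarrow> 0"
    by real_asymp
  have lim: "(\<lambda>n. - (real Q - 1) * (a n * ln (a n)) - b n * ln (b n) - Q * (1 + ln n) / n)
    \<longlonglongrightarrow> - (real Q - 1) * (x / (real Q - 1) * ln (x / (real Q - 1))) - (1 - x) * ln (1 - x) - 0"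
    by (intro tendsto_intros al bl err)
  have lim_eq: "- (real Q - 1) * (x / (real Q - 1) * ln (x / (real Q - 1))) - (1 - x) * ln (1 - x) - 0 =
      entropy Q x * ln Q"
    unfolding entropy_ln[OF Q] using Q1 x by (cases "x = 0") (simp_all add: ln_div field_simps)
  have "\<forall>\<^sub>F n in sequentially. - (real Q - 1) * (a n * ln (a n)) - b n * ln (b n) - Q * (1 + ln n) / n
    = (n * ln n - (real Q - 1) * (m n * ln (m n)) - z n * ln (z n) - Q * (1 + ln n)) / n"
  proof (rule eventually_sequentiallyI[of 1])
    fix n :: nat assume n: "1 \<le> n"
    have div: "real w / n * ln (real w / n) = (w * ln w - w * ln n) / n" for w :: nat
      using n by (cases "w = 0") (simp_all add: ln_div field_simps)
    show "- (real Q - 1) * (a n * ln (a n)) - b n * ln (b n) - Q * (1 + ln n) / n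
      = (n * ln n - (real Q - 1) * (m n * ln (m n)) - z n * ln (z n) - Q * (1 + ln n)) / n"
    proof -
      \<comment> \<open>Splitting \<open>n * ln n\<close> according to the multiplicities turns
        logarithms of counts into logarithms of frequencies.\<close>
      have e: "real n * ln n = (real Q - 1) * (m n * ln n) + z n * ln n" unfolding zr by (simp add:
          algebra_simps)
      show ?thesis unfolding a_def b_def div e using n by (simp add: field_simps)
    qed
  qed
  from Lim_transform_eventually[OF lim this]
  show "(\<lambda>n. (n * ln n - (real Q - 1) * (m n * ln (m n)) - z n * ln (z n) - Q * (1 + ln n)) / n)
      \<longlonglongrightarrow> entropy Q x * ln Q" unfolding lim_eq .
qed

section \<open>Matrices, codes and the sphere covering bound\<close>

text \<open>Coordinates with respect to a basis give a bijection with the functions from the basis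
  to the field. A basis exists because the finite set \<open>C\<close> spans itself.\<close>

lemma card_linear_code:
  fixes C :: "'a::{field,finite} vec set"
  assumes C: "linear_code n C"
  shows "card C = CARD('a) ^ code_dim n C"
proof -
  let ?V = "(module_vec TYPE('a) n)\<lparr>carrier := C\<rparr>"
  have vs: "vectorspace class_ring ?V"
    using vectorspace.subspace_is_vs[OF vec_vs] C unfolding linear_code_def by blast
  interpret V: vectorspace class_ring ?V by (rule vs)
  have finC: "finite C" using linear_code_subset[OF C] finite_carrier_vec finite_subset by blast
  have "V.span C = C"
    using V.in_own_span[of C] V.span_is_subset2[of C] by auto
  hence "V.fin_dim" unfolding V.fin_dim_def using finC by (intro exI[of _ C]) auto
  then obtain B where B: "finite B" "V.basis B" using V.finite_basis_exists by blast
  have BC: "B \<subseteq> carrier ?V" using B(2) unfolding V.basis_def by blast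
  have crit: "\<forall>v. v \<in> C \<longrightarrow> (\<exists>!a. a \<in> B \<rightarrow>\<^sub>E UNIV \<and> V.lincomb a B = v)"
    using V.basis_criterion[OF B(1) BC] B(2) by (simp add: class_ring_simps)
  have "bij_betw (\<lambda>a. V.lincomb a B) (B \<rightarrow>\<^sub>E UNIV) C"
  proof (rule bij_betw_imageI)
    have lc: "V.lincomb a B \<in> C" for a
      using V.lincomb_closed[OF BC, of a] by (simp add: class_ring_simps)
    show "inj_on (\<lambda>a. V.lincomb a B) (B \<rightarrow>\<^sub>E UNIV)"
      using crit lc by (intro inj_onI) blast
    show "(\<lambda>a. V.lincomb a B) ` (B \<rightarrow>\<^sub>E UNIV) = C"
      using crit lc by (intro equalityI subsetI) (blast, metis imageI)
  qed
  hence "card C = card (B \<rightarrow>\<^sub>E (UNIV :: 'a set))" by (metis bij_betw_same_card)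
  also have "\<dots> = CARD('a) ^ card B" using B(1) by (simp add: card_PiE)
  also have "card B = code_dim n C" unfolding code_dim_def using V.dim_basis[OF B] by simp
  finally show ?thesis .
qed

lemma linear_code_vec_image:
  fixes C :: "(nat \<Rightarrow> 'a::{field,finite}) set"
  assumes C: "fun_vs.subspace C"
  shows "linear_code n (vec n ` C)"
  unfolding linear_code_def subspace_def LinearCombinations.submodule_def
proof (intro conjI allI impI)
  show "vectorspace class_ring (module_vec TYPE('a) n)" by (rule vec_vs)
  show "module class_ring (module_vec TYPE('a) n)" by (rule vec_module)
  show "vec n ` C \<subseteq> carrier (module_vec TYPE('a) n)" by (auto simp: module_vec_simps)
  have "vec n 0 = 0\<^sub>v n" by (intro eq_vecI) auto
  thus "\<zero>\<^bsub>module_vec TYPE('a) n\<^esub> \<in> vec n ` C"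
    using fun_vs.subspace_0[OF C] unfolding module_vec_simps by (metis imageI)
next
  fix v w :: "'a vec" assume "v \<in> vec n ` C" "w \<in> vec n ` C"
  then obtain x y where xy: "x \<in> C" "y \<in> C" "v = vec n x" "w = vec n y" by blast
  have "v + w = vec n (x + y)" unfolding xy by (intro eq_vecI) auto
  thus "v \<oplus>\<^bsub>module_vec TYPE('a) n\<^esub> w \<in> vec n ` C"
    using fun_vs.subspace_add[OF C xy(1,2)] unfolding module_vec_simps by (metis imageI)
next
  fix c :: 'a and v assume "v \<in> vec n ` C"
  then obtain x where x: "x \<in> C" "v = vec n x" by blast
  have "c \<cdot>\<^sub>v v = vec n (\<lambda>i. c * x i)" unfolding x by (intro eq_vecI) auto
  thus "c \<odot>\<^bsub>module_vec TYPE('a) n\<^esub> v \<in> vec n ` C"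
    using fun_vs.subspace_scale[OF C x(1)] unfolding module_vec_simps by (metis imageI)
qed

text \<open>The bridge from the matrix type to words over columns; positions outside the matrix
  become 0 to match \<open>tuples\<close>.\<close>

definition mat_cols :: "'a::zero mat \<Rightarrow> nat \<Rightarrow> nat \<Rightarrow> 'a" where
  "mat_cols u j i = (if i < dim_row u \<and> j < dim_col u then u $$ (i, j) else 0)"

lemma mat_cols_tuples: "u \<in> carrier_mat t n \<Longrightarrow> mat_cols u \<in> tuples n (\<lambda>_. coords t)"
  by (auto simp: tuples_def mat_cols_def fun_eq_iff)

lemma t_weight_mat_cols:
  fixes u :: "'a::{field,finite} mat"
  assumes "u \<in> carrier_mat t n"
  shows "t_weight u = card {j. j < n \<and> mat_cols u j \<noteq> 0}"
proof -
  have "col u j \<noteq> 0\<^sub>v (dim_row u) \<longleftrightarrow> mat_cols u j \<noteq> 0" if "j < n" for j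
    using assms that by (auto simp: mat_cols_def fun_eq_iff vec_eq_iff)
  thus ?thesis using assms unfolding t_weight_def by (metis (no_types, lifting) Collect_cong carrier_matD(2))
qed

lemma mat_cols_diff:
  fixes c u :: "'a::{field,finite} mat"
  assumes "c \<in> carrier_mat t n" "u \<in> carrier_mat t n"
  shows "mat_cols (c - u) = mat_cols c - mat_cols u"
  using assms by (auto simp: mat_cols_def fun_eq_iff)

lemma mat_cols_mat:
  assumes "e \<in> tuples n (\<lambda>_. coords t)"
  shows "mat_cols (mat t n (\<lambda>(i, j). e j i)) = e"
proof (intro ext)
  fix j i
  have "e j i = 0" if "\<not> (i < t \<and> j < n)"
    using assms that by (cases "j < n") (auto simp: tuples_def)
  thus "mat_cols (mat t n (\<lambda>(i, j). e j i)) j i = e j i" by (auto simp: mat_cols_def)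
qed

lemma words_weight:
  fixes e :: "nat \<Rightarrow> 'b::zero"
  assumes "size M = n" "e \<in> words n M"
  shows "card {j. j < n \<and> e j \<noteq> 0} = n - count M 0"
proof -
  have "{j. j < n \<and> e j = 0} = {j. j < length (map e [0..<n]) \<and> map e [0..<n] ! j = 0}" by auto
  hence "card {j. j < n \<and> e j = 0} = length (filter (\<lambda>v. v = 0) (map e [0..<n]))"
    by (simp only: length_filter_conv_card)
  also have "length (filter (\<lambda>v. v = 0) xs) = count (mset xs) 0" for xs :: "'b list"
    by (induction xs) auto
  also have "mset (map e [0..<n]) = M" using assms(2) by (simp add: words_def)
  finally have "card {j. j < n \<and> e j = 0} = count M 0" .
  moreover have "{j. j < n \<and> e j \<noteq> 0} = {..<n} - {j. j < n \<and> e j = 0}" by auto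
  hence "card {j. j < n \<and> e j \<noteq> 0} = n - card {j. j < n \<and> e j = 0}"
    by (simp add: card_Diff_subset subset_iff)
  ultimately show ?thesis by simp
qed

section \<open>Covering radius\<close>

lemma covering_radius_le:
  fixes C :: "'a::{field,finite} vec set"
  assumes "\<And>u. u \<in> carrier_mat t n \<Longrightarrow> \<exists>c\<in>code_power t n C. t_dist c u \<le> r"
  shows "covering_radius t n C \<le> r"
proof -
  have "Min ((\<lambda>c. t_dist c u) ` code_power t n C) \<le> r" if u: "u \<in> carrier_mat t n" for u
  proof -
    obtain c where c: "c \<in> code_power t n C" "t_dist c u \<le> r" using assms[OF u] by blast
    have "Min ((\<lambda>c. t_dist c u) ` code_power t n C) \<le> t_dist c u"
      using c(1) finite_code_power by (intro Min_le) auto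
    thus ?thesis using c(2) by simp
  qed
  thus ?thesis unfolding covering_radius_def
    using finite_carrier_mat[of t n] carrier_mat_nonempty[of t n] by (subst Max_le_iff) auto
qed

lemma covering_radiusD:
  fixes C :: "'a::{field,finite} vec set"
  assumes C: "C \<noteq> {}" "C \<subseteq> carrier_vec n" and u: "u \<in> carrier_mat t n"
  shows "\<exists>c\<in>code_power t n C. t_dist c u \<le> covering_radius t n C"
proof -
  have "Min ((\<lambda>c. t_dist c u) ` code_power t n C) \<in> (\<lambda>c. t_dist c u) ` code_power t n C"
    using finite_code_power code_power_nonempty[OF C] by (intro Min_in) auto
  moreover have "Min ((\<lambda>c. t_dist c u) ` code_power t n C) \<le> covering_radius t n C"
    unfolding covering_radius_def using finite_carrier_mat u by (intro Max_ge) auto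
  ultimately show ?thesis by auto
qed

lemma covering_radius_vec_image_le:
  fixes C :: "(nat \<Rightarrow> 'a::{field,finite}) set"
  assumes C: "C \<subseteq> coords n" and M: "size M = n"
    and cov: "\<forall>u\<in>tuples n (\<lambda>_. coords t). \<exists>c\<in>rows_power t n C. c + u \<in> words n M"
  shows "covering_radius t n (vec n ` C) \<le> n - count M 0"
proof (rule covering_radius_le)
  fix u :: "'a mat" assume u: "u \<in> carrier_mat t n"
  \<comment> \<open>The covering hypothesis speaks of \<open>c + u\<close>, so it is applied to the
    negated centre. The resulting word has exactly \<open>n - count M 0\<close> nonzero
    columns.\<close>
  have "- mat_cols u \<in> tuples n (\<lambda>_. coords t)" using mat_cols_tuples[OF u] by (auto simp: tuples_def)
  then obtain c where c: "c \<in> rows_power t n C" "c + - mat_cols u \<in> words n M" using cov by blast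
  define D where "D = mat t n (\<lambda>(i, j). c j i)"
  have D: "D \<in> carrier_mat t n" by (simp add: D_def)
  have "row D i = vec n (\<lambda>j. c j i)" if "i < t" for i using that by (intro eq_vecI) (auto simp: D_def)
  moreover have "(\<lambda>j. c j i) \<in> C" if "i < t" for i using c(1) that by (simp add: rows_power_def)
  ultimately have "D \<in> code_power t n (vec n ` C)" using D by (auto simp: code_power_def)
  moreover have "t_dist D u \<le> n - count M 0"
  proof -
    have "mat_cols D = c"
      using c(1) mat_cols_mat[of c n t] by (simp add: D_def rows_power_def)
    hence "mat_cols (D - u) = c + - mat_cols u" using mat_cols_diff[OF D u] by simp
    hence "t_weight (D - u) = card {j. j < n \<and> (c + - mat_cols u) j \<noteq> 0}"
      using t_weight_mat_cols[of "D - u" t n] u by (simp only: minus_carrier_mat)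
    thus ?thesis using words_weight[OF M c(2)] by (simp add: t_dist_def)
  qed
  ultimately show "\<exists>c\<in>code_power t n (vec n ` C). t_dist c u \<le> n - count M 0" by blast
qed

text \<open>Sort the words by their support: on a support of size \<open>i\<close> each column is
  one of \<open>Q - 1\<close> nonzero vectors.\<close>

lemma card_weight_ball:
  fixes r :: real and t n :: nat
  defines "Q \<equiv> CARD('a::{field,finite}) ^ t"
  shows "real (card {e \<in> tuples n (\<lambda>_. coords t :: (nat \<Rightarrow> 'a) set). real (card {j. j < n \<and> e j \<noteq> 0}) \<le> r})
    = (\<Sum>i\<in>{i. i \<le> n \<and> real i \<le> r}. real (n choose i) * (real Q - 1) ^ i)"
proof -
  let ?V = "coords t :: (nat \<Rightarrow> 'a) set"
  let ?supp = "\<lambda>e::nat \<Rightarrow> nat \<Rightarrow> 'a. {j. j < n \<and> e j \<noteq> 0}"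
  let ?I = "{i. i \<le> n \<and> real i \<le> r}"
  let ?W = "tuples n (\<lambda>_. ?V)"
  have finW: "finite ?W" by (intro finite_tuples finite_coords)
  have V0: "card (?V - {0}) = Q - 1"
    by (simp only: card_Diff_singleton[OF zero_coords] card_coords Q_def)
  have Q1: "Q \<ge> 1" by (simp add: Q_def Suc_le_eq)
  have supp: "card {e \<in> ?W. ?supp e = S} = (Q - 1) ^ card S" if S: "S \<subseteq> {..<n}" for S
  proof -
    have "{e \<in> ?W. ?supp e = S} = tuples n (\<lambda>j. if j \<in> S then ?V - {0} else {0})"
      using S zero_coords[of t] by (auto simp: tuples_def split: if_splits)
    also have "card \<dots> = (\<Prod>j<n. if j \<in> S then Q - 1 else 1)"
      unfolding card_tuples using V0 by (intro prod.cong) auto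
    also have "\<dots> = (Q - 1) ^ card ({..<n} \<inter> S)" by (simp add: prod.If_cases)
    also have "{..<n} \<inter> S = S" using S by blast
    finally show ?thesis .
  qed
  have wt: "card {e \<in> ?W. card (?supp e) = i} = (n choose i) * (Q - 1) ^ i" for i
  proof -
    have "card {e \<in> ?W. card (?supp e) = i}
      = (\<Sum>S\<in>{S. S \<subseteq> {..<n} \<and> card S = i}. card {e \<in> {e \<in> ?W. card (?supp e) = i}. ?supp e = S})"
      using finW by (intro card_eq_sum_fibres) auto
    also have "\<dots> = (\<Sum>S\<in>{S. S \<subseteq> {..<n} \<and> card S = i}. (Q - 1) ^ i)"
    proof (rule sum.cong[OF refl])
      fix S assume S: "S \<in> {S. S \<subseteq> {..<n} \<and> card S = i}"
      hence "{e \<in> {e \<in> ?W. card (?supp e) = i}. ?supp e = S} = {e \<in> ?W. ?supp e = S}" by blast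
      thus "card {e \<in> {e \<in> ?W. card (?supp e) = i}. ?supp e = S} = (Q - 1) ^ i" using supp S by simp
    qed
    also have "\<dots> = (n choose i) * (Q - 1) ^ i" by (simp add: n_subsets)
    finally show ?thesis .
  qed
  have "card {e \<in> ?W. real (card (?supp e)) \<le> r}
    = (\<Sum>i\<in>?I. card {e \<in> {e \<in> ?W. real (card (?supp e)) \<le> r}. card (?supp e) = i})"
  proof (rule card_eq_sum_fibres)
    have "card (?supp e) \<le> n" for e using card_mono[of "{..<n}" "?supp e"] by auto
    thus "(\<lambda>e. card (?supp e)) ` {e \<in> ?W. real (card (?supp e)) \<le> r} \<subseteq> ?I" by auto
  qed (use finW in auto)
  also have "\<dots> = (\<Sum>i\<in>?I. (n choose i) * (Q - 1) ^ i)"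
  proof (rule sum.cong[OF refl])
    fix i assume "i \<in> ?I"
    hence "{e \<in> {e \<in> ?W. real (card (?supp e)) \<le> r}. card (?supp e) = i} = {e \<in> ?W. card (?supp e) = i}" by auto
    thus "card {e \<in> {e \<in> ?W. real (card (?supp e)) \<le> r}. card (?supp e) = i} = (n choose i) * (Q - 1) ^ i"
      using wt[of i] by simp
  qed
  finally show ?thesis using Q1 by (simp add: of_nat_diff)
qed

section \<open>Sphere covering\<close>

lemma card_code_power_le:
  fixes C :: "'a::{field,finite} vec set"
  assumes "finite C"
  shows "card (code_power t n C) \<le> card C ^ t"
proof -
  have "inj_on (\<lambda>c. restrict (row c) {..<t}) (code_power t n C)"
  proof (rule inj_onI)
    fix c d assume a: "c \<in> code_power t n C" "d \<in> code_power t n C" "restrict (row c) {..<t} = restrict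
        (row d) {..<t}"
    have r: "row c i = row d i" if "i < t" for i using fun_cong[OF a(3), of i] that by simp
    show "c = d" using a(1,2) r by (intro eq_rowI) (auto simp: code_power_def)
  qed
  moreover have "(\<lambda>c. restrict (row c) {..<t}) ` code_power t n C \<subseteq> (\<Pi>\<^sub>E i\<in>{..<t}. C)"
    by (auto simp: code_power_def)
  moreover have "finite (\<Pi>\<^sub>E i\<in>{..<t}. C)" using assms by (intro finite_PiE) auto
  ultimately have "card (code_power t n C) \<le> card (\<Pi>\<^sub>E i\<in>{..<t}. C)" by (rule card_inj_on_le)
  thus ?thesis by (simp add: card_PiE)
qed

text \<open>Every word is a matrix over the code minus an error of weight at most \<open>r\<close>,
  and at most \<open>card C ^ t\<close> matrices have all rows in \<open>C\<close>.\<close>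

lemma sphere_covering_bound:
  fixes C :: "'a::{field,finite} vec set" and t n :: nat
  assumes C: "C \<in> covering_codes t n r"
  defines "Q \<equiv> CARD('a) ^ t"
  shows "real Q ^ n \<le> real (card C) ^ t * (\<Sum>i\<in>{i. i \<le> n \<and> real i \<le> r}. real (n choose i) * (real Q - 1) ^ i)"
proof -
  let ?W = "tuples n (\<lambda>_. coords t :: (nat \<Rightarrow> 'a) set)"
  let ?B = "{e \<in> ?W. real (card {j. j < n \<and> e j \<noteq> 0}) \<le> r}"
  have C': "C \<noteq> {}" "C \<subseteq> carrier_vec n" "real (covering_radius t n C) \<le> r"
    using C by (auto simp: covering_codes_def)
  have finC: "finite C" using C'(2) finite_carrier_vec finite_subset by blast
  have finW: "finite ?W" by (intro finite_tuples finite_coords)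
  have sub: "?W \<subseteq> (\<lambda>(c, e). mat_cols c - e) ` (code_power t n C \<times> ?B)"
  proof
    fix w assume w: "w \<in> ?W"
    define u where "u = mat t n (\<lambda>(i, j). w j i)"
    have u: "u \<in> carrier_mat t n" by (simp add: u_def)
    have wu: "mat_cols u = w" unfolding u_def by (rule mat_cols_mat[OF w])
    obtain c where c: "c \<in> code_power t n C" "t_dist c u \<le> covering_radius t n C"
      using covering_radiusD[OF C'(1,2) u] by blast
    have cm: "c \<in> carrier_mat t n" using c(1) by (simp add: code_power_def)
    have "t_dist c u = card {j. j < n \<and> mat_cols (c - u) j \<noteq> 0}"
      unfolding t_dist_def using u by (intro t_weight_mat_cols) auto
    hence "real (card {j. j < n \<and> mat_cols (c - u) j \<noteq> 0}) \<le> r" using c(2) C'(3) by linarith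
    moreover have "mat_cols (c - u) \<in> ?W" using u by (intro mat_cols_tuples) auto
    ultimately have "mat_cols (c - u) \<in> ?B" by blast
    moreover have "w = mat_cols c - mat_cols (c - u)" using mat_cols_diff[OF cm u] wu by simp
    ultimately show "w \<in> (\<lambda>(c, e). mat_cols c - e) ` (code_power t n C \<times> ?B)" using c(1) by force
  qed
  have finCB: "finite (code_power t n C \<times> ?B)" using finW by (intro finite_cartesian_product
      finite_code_power) simp
  have "card ?W \<le> card ((\<lambda>(c, e). mat_cols c - e) ` (code_power t n C \<times> ?B))"
    using finCB by (intro card_mono[OF _ sub]) auto
  also have "\<dots> \<le> card (code_power t n C \<times> ?B)" by (rule card_image_le[OF finCB])
  also have "\<dots> = card (code_power t n C) * card ?B" by (rule card_cartesian_product)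
  also have "\<dots> \<le> card C ^ t * card ?B" using card_code_power_le[OF finC] by (rule mult_right_mono) simp
  also have "card ?W = Q ^ n" by (simp add: card_tuples card_coords Q_def)
  finally have "real (Q ^ n) \<le> real (card C ^ t * card ?B)" by (simp only: of_nat_le_iff)
  thus ?thesis using card_weight_ball[where 'a = 'a and t = t and n = n and r = r] by (simp add: Q_def)
qed

section \<open>The limit\<close>

lemma card_field_ge_2: "CARD('a::{field,finite}) \<ge> 2"
proof -
  have "card {0::'a, 1} \<le> CARD('a)" by (intro card_mono) auto
  thus ?thesis by simp
qed

lemma k_cov_attained:
  assumes "r \<ge> 0"
  obtains C where "C \<in> (covering_codes t n r :: 'a::{field,finite} vec set set)"
    "k_cov TYPE('a) t n r = log (real CARD('a)) (real (card C))"
proof -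
  have "k_cov TYPE('a) t n r \<in> (\<lambda>C. log (real CARD('a)) (real (card C))) ` (covering_codes t n r :: 'a vec
      set set)"
    unfolding k_cov_def by (intro Min_in finite_imageI finite_covering_codes) (simp add:
        covering_codes_nonempty[OF assms])
  thus ?thesis using that by blast
qed

lemma k_cov_le:
  assumes "C \<in> (covering_codes t n r :: 'a::{field,finite} vec set set)"
  shows "k_cov TYPE('a) t n r \<le> log (real CARD('a)) (real (card C))"
  unfolding k_cov_def using assms finite_covering_codes by (intro Min_le) auto

lemma k_cov_lin_le:
  assumes "C \<in> (linear_covering_codes t n r :: 'a::{field,finite} vec set set)"
  shows "k_cov_lin TYPE('a) t n r \<le> code_dim n C"
  unfolding k_cov_lin_def using assms finite_linear_covering_codes by (intro Min_le) auto

text \<open>An optimal linear code competes in the unrestricted minimum, and the logarithm of its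
  size is its dimension.\<close>

lemma k_cov_le_k_cov_lin:
  assumes "r \<ge> 0"
  shows "k_cov TYPE('a::{field,finite}) t n r \<le> real (k_cov_lin TYPE('a) t n r)"
proof -
  have "k_cov_lin TYPE('a) t n r \<in> code_dim n ` (linear_covering_codes t n r :: 'a vec set set)"
    unfolding k_cov_lin_def
    by (intro Min_in finite_imageI finite_linear_covering_codes) (simp add:
        linear_covering_codes_nonempty[OF assms])
  then obtain C where C: "C \<in> (linear_covering_codes t n r :: 'a vec set set)" "k_cov_lin TYPE('a) t n r =
      code_dim n C"
    by blast
  have "linear_code n C" using C(1) by (simp add: linear_covering_codes_def)
  hence "log (real CARD('a)) (real (card C)) = real (code_dim n C)"
    using card_linear_code[of n C] card_field_ge_2[where 'a = 'a] by (simp add: log_nat_power)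
  moreover have "C \<in> covering_codes t n r" using C(1) linear_covering_codes_subset by blast
  ultimately show ?thesis using k_cov_le[of C t n r] C(2) by simp
qed

lemma k_cov_nonneg:
  assumes "r \<ge> 0"
  shows "0 \<le> k_cov TYPE('a::{field,finite}) t n r"
proof -
  obtain C where C: "C \<in> (covering_codes t n r :: 'a vec set set)"
    "k_cov TYPE('a) t n r = log (real CARD('a)) (real (card C))" by (rule k_cov_attained[OF assms])
  have "C \<noteq> {}" "finite C" using C(1) finite_carrier_vec finite_subset by (auto simp: covering_codes_def)
  hence "card C \<ge> 1" by (simp add: Suc_le_eq card_gt_0_iff)
  thus ?thesis unfolding C(2) using card_field_ge_2[where 'a = 'a] by (intro zero_le_log_cancel_iff[THEN
      iffD2]) auto
qed

text \<open>Logarithms of the sphere covering bound. Since \<open>ln Q = t * ln q\<close>, the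
  factor \<open>t\<close> from \<open>card C ^ t\<close> cancels, and the bound holds for every
  \<open>n\<close>.\<close>

lemma k_cov_ge:
  assumes t: "t \<ge> 1" and x: "0 \<le> x" "x \<le> 1 - 1 / real (CARD('a::{field,finite}) ^ t)"
  shows "real n * (1 - entropy (CARD('a) ^ t) x) \<le> k_cov TYPE('a) t n (x * real n)"
proof -
  define q where "q = real CARD('a)"
  define Q where "Q = CARD('a) ^ t"
  have q2: "q \<ge> 2" using card_field_ge_2[where 'a = 'a] by (simp add: q_def)
  have Q2: "Q \<ge> 2"
  proof -
    have "CARD('a) ^ 1 \<le> CARD('a) ^ t" using t card_field_ge_2[where 'a = 'a] by (intro power_increasing) auto
    thus ?thesis using card_field_ge_2[where 'a = 'a] by (simp add: Q_def)
  qed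
  have Qq: "real Q = q ^ t" by (simp add: Q_def q_def)
  obtain C where C: "C \<in> (covering_codes t n (x * real n) :: 'a vec set set)"
    "k_cov TYPE('a) t n (x * real n) = log q (real (card C))"
    unfolding q_def using k_cov_attained[of "x * real n" t n] x by auto
  have "C \<noteq> {}" "finite C" using C(1) finite_carrier_vec finite_subset by (auto simp: covering_codes_def)
  hence cC: "real (card C) > 0" by (simp add: card_gt_0_iff)
  have "real Q ^ n \<le> real (card C) ^ t * (\<Sum>i\<in>{i. i \<le> n \<and> real i \<le> x * n}. real (n choose i) * (real Q - 1) ^ i)"
    unfolding Q_def by (rule sphere_covering_bound[OF C(1)])
  also have "\<dots> \<le> real (card C) ^ t * real Q powr (n * entropy Q x)"
    using Q2 x unfolding Q_def[symmetric] by (intro mult_left_mono ball_volume_le) auto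
  finally have "ln (real Q ^ n) \<le> ln (real (card C) ^ t * real Q powr (n * entropy Q x))"
    using Q2 by (intro ln_mono) auto
  also have "ln (real (card C) ^ t * real Q powr (n * entropy Q x)) = t * ln (real (card C)) + n * entropy
      Q x * ln Q"
    using cC Q2 by (simp add: ln_mult ln_realpow ln_powr)
  also have "ln (real Q ^ n) = n * ln Q" using Q2 by (simp add: ln_realpow)
  also have "ln (real Q) = t * ln q" unfolding Qq using q2 by (simp add: ln_realpow)
  finally have "t * (n * (1 - entropy Q x) * ln q) \<le> t * ln (real (card C))" by (simp add: algebra_simps)
  hence "n * (1 - entropy Q x) * ln q \<le> ln (real (card C))" using t by (simp add: mult_le_cancel_left)
  hence "n * (1 - entropy Q x) \<le> ln (real (card C)) / ln q" using q2 by (simp add: pos_le_divide_eq)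
  thus ?thesis unfolding C(2) log_def Q_def .
qed

text \<open>The relative weight \<open>x\<close> of the words is kept apart from
  \<open>\<rho>\<close>: below the threshold \<open>x = \<rho>\<close> is used, above it the
  maximiser \<open>1 - 1 / Q\<close> of the entropy.\<close>

lemma kappa_lin_le:
  assumes t: "t \<ge> 1" and x: "0 \<le> x" "x \<le> 1 - 1 / real (CARD('a::{field,finite}) ^ t)" "x \<le> \<rho>"
  shows "kappa_lin TYPE('a) t \<rho> \<le> ereal (1 - entropy (CARD('a) ^ t) x)"
proof -
  define q where "q = real CARD('a)"
  define Q where "Q = CARD('a) ^ t"
  have q2: "q \<ge> 2" using card_field_ge_2[where 'a = 'a] by (simp add: q_def)
  have lnq: "ln q > 0" using q2 by simp
  have Q2: "Q \<ge> 2"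
  proof -
    have "CARD('a) ^ 1 \<le> CARD('a) ^ t" using t card_field_ge_2[where 'a = 'a] by (intro power_increasing) auto
    thus ?thesis using card_field_ge_2[where 'a = 'a] by (simp add: Q_def)
  qed
  have lnQ: "ln (real Q) = t * ln q" unfolding Q_def q_def using card_field_ge_2[where 'a = 'a] by (simp
      add: ln_realpow)
  have "1 / real Q > 0" using Q2 by simp
  hence x1: "x < 1" using x unfolding Q_def[symmetric] by linarith
  define m where "m n = nat \<lfloor>x / (real Q - 1) * real n\<rfloor>" for n :: nat
  define z where "z n = n - (Q - 1) * m n" for n
  define E where "E = (\<lambda>n. (n * ln n - (real Q - 1) * (m n * ln (m n)) - z n * ln (z n) - Q * (1 + ln n)) / n)"
  note lim = entropy_limit[OF Q2 x(1) x1 m_def z_def, folded E_def]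
  \<comment> \<open>The hypothesis on \<open>k\<close> in \<open>exists_covering_subspace\<close>
    solved for \<open>k\<close> by taking logarithms, with the lower bound \<open>n * E n\<close> in
    place of the logarithm of the number of words.\<close>
  define a where "a = (\<lambda>n. real n + Q * ln 2 / ln q - n * E n / (t * ln q))"
  define k where "k = (\<lambda>n. nat \<lceil>a n\<rceil>)"
  \<comment> \<open>Ensures \<open>2 ^ i \<ge> t * n * q\<close>, and \<open>q < 2 ^ q\<close> then
    gives \<open>q ^ (t * n) < 2 ^ (2 ^ i)\<close>. Only logarithmically many rounds are
    used.\<close>
  define i where "i = (\<lambda>n::nat. nat \<lceil>log 2 (t * n * q)\<rceil>)"
  \<comment> \<open>An upper bound for \<open>(k n + t * i n) / n\<close>. The maximum with 0
    reflects the truncation of \<open>k n\<close> at 0, and the extra ones come from rounding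
    up.\<close>
  define U where "U = (\<lambda>n::nat. max 0 (1 + Q * ln 2 / ln q / n - E n / (t * ln q)) + 1 / n + t * (log 2 (t
      * n * q) + 1) / n)"
  have dim: "k_cov_lin TYPE('a) t n (\<rho> * real n) \<le> k n + t * i n" if n: "n \<ge> 1" for n
  proof -
    let ?V = "coords t :: (nat \<Rightarrow> 'a) set"
    let ?M = "column_mset (m n) (z n) ?V"
    let ?P = "card (permutations_of_multiset ?M)"
    have V: "finite ?V" "0 \<in> ?V" by (rule finite_coords, rule zero_coords)
    have cV: "card ?V = Q" by (simp add: card_coords Q_def)
    have nz: "n = (Q - 1) * m n + z n" using lim(1)[of n] by (simp add: z_def)
    have posP: "real ?P > 0" by (simp add: card_gt_0_iff)
    have "n * E n \<le> ln ?P"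
      using ln_card_permutations_ge[OF V, of n "m n" "z n", unfolded cV, OF nz n] n
      by (simp add: E_def)
    hence "n * E n / (t * ln q) \<le> ln ?P / (t * ln q)" using lnq by (intro divide_right_mono) auto
    moreover have "a n \<le> real (k n)" unfolding k_def by linarith
    ultimately have "real n + Q * ln 2 / ln q \<le> real (k n) + ln ?P / (t * ln q)" unfolding a_def by linarith
    hence "(real n + Q * ln 2 / ln q) * ln q \<le> (real (k n) + ln ?P / (t * ln q)) * ln q"
      using lnq by (intro mult_right_mono) auto
    hence "real n * ln q + Q * ln 2 \<le> real (k n) * ln q + 1 / t * ln ?P"
      using lnq t by (simp add: distrib_right)
    hence "exp (real n * ln q + real Q * ln 2) \<le> exp (real (k n) * ln q + 1 / t * ln ?P)" by simp
    also have "exp (real n * ln q + real Q * ln 2) = q ^ n * 2 ^ Q"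
      unfolding exp_add exp_of_nat_mult using q2 by simp
    also have "exp (real (k n) * ln q + 1 / t * ln ?P) = q ^ k n * real ?P powr (1 / t)"
      unfolding exp_add exp_of_nat_mult using q2 posP by (simp add: powr_def)
    finally have kk: "real CARD('a) ^ n * 2 ^ (CARD('a) ^ t) \<le> real CARD('a) ^ k n * real ?P powr (1 / t)"
      unfolding q_def Q_def .
    have ii: "CARD('a) ^ (t * n) < 2 ^ (2 ^ i n)"
    proof -
      have tn: "t * n * CARD('a) > 0" using t n card_field_ge_2[where 'a = 'a] by simp
      have "log 2 (real (t * n * CARD('a))) \<le> real (i n)" unfolding i_def q_def by (simp add: of_nat_ceiling)
      hence "real (t * n * CARD('a)) \<le> 2 powr real (i n)" using tn by (subst (asm) log_le_iff) auto
      hence "real (t * n * CARD('a)) \<le> real (2 ^ i n)" by (simp add: powr_realpow)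
      hence le: "t * n * CARD('a) \<le> 2 ^ i n" by (simp only: of_nat_le_iff)
      have "CARD('a) ^ (t * n) < (2 ^ CARD('a)) ^ (t * n)"
        using t n by (intro power_strict_mono less_exp) auto
      also have "\<dots> = 2 ^ (t * n * CARD('a))" by (simp add: power_mult mult.commute flip: power_mult)
      also have "\<dots> \<le> 2 ^ (2 ^ i n)" using le by (intro power_increasing) auto
      finally show ?thesis .
    qed
    obtain C where C: "fun_vs.subspace C" "C \<subseteq> coords n" "card C \<le> CARD('a) ^ (k n + t * i n)"
      "\<forall>u\<in>tuples n (\<lambda>_. ?V). \<exists>c\<in>rows_power t n C. c + u \<in> words n ?M"
      using exists_covering_subspace[OF t nz[unfolded Q_def] kk ii] by blast
    let ?K = "vec n ` C"
    have lin: "linear_code n ?K" by (rule linear_code_vec_image[OF C(1)])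
    have size: "size ?M = n" using size_column_mset[OF V, of "m n" "z n"] nz cV by simp
    have "covering_radius t n ?K \<le> n - count ?M 0" by (rule covering_radius_vec_image_le[OF C(2) size C(4)])
    also have "count ?M 0 = z n" by (simp add: count_column_mset finite_coords)
    also have "n - z n = (Q - 1) * m n" using nz by simp
    finally have "real (covering_radius t n ?K) \<le> real ((Q - 1) * m n)" by (simp only: of_nat_le_iff)
    also have "\<dots> \<le> x * n" by (rule lim(2))
    also have "\<dots> \<le> \<rho> * n" using x by (intro mult_right_mono) auto
    finally have "?K \<in> linear_covering_codes t n (\<rho> * n)" using lin by (simp add: linear_covering_codes_def)
    hence "k_cov_lin TYPE('a) t n (\<rho> * real n) \<le> code_dim n ?K" by (rule k_cov_lin_le)
    also have "code_dim n ?K \<le> k n + t * i n"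
    proof -
      have "finite C" using C(2) finite_coords finite_subset by blast
      hence "card ?K \<le> CARD('a) ^ (k n + t * i n)" using card_image_le[of C "vec n"] C(3) by linarith
      hence "CARD('a) ^ code_dim n ?K \<le> CARD('a) ^ (k n + t * i n)" by (simp only: card_linear_code[OF lin])
      thus ?thesis using card_field_ge_2[where 'a = 'a] by (simp add: power_le_imp_le_exp)
    qed
    finally show ?thesis .
  qed
  have le: "ereal (real (k_cov_lin TYPE('a) t n (\<rho> * real n)) / real n) \<le> ereal (U n)" if n: "n \<ge> 1" for n
  proof -
    have "real (k n) \<le> max 0 (a n) + 1" unfolding k_def by linarith
    moreover have "real (i n) \<le> log 2 (t * n * q) + 1"
    proof -
      have "1 * 1 * 1 \<le> real t * real n * q" using t n q2 by (intro mult_mono) auto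
      hence "log 2 (real t * real n * q) \<ge> 0" by (simp add: zero_le_log_cancel_iff)
      thus ?thesis unfolding i_def by simp
    qed
    hence "t * real (i n) \<le> t * (log 2 (t * n * q) + 1)" by (intro mult_left_mono) auto
    moreover have "real (k_cov_lin TYPE('a) t n (\<rho> * real n)) \<le> real (k n + t * i n)" using dim[OF n] by
        (simp only: of_nat_le_iff)
    ultimately have "real (k_cov_lin TYPE('a) t n (\<rho> * real n)) \<le> max 0 (a n) + 1 + t * (log 2 (t * n * q)
        + 1)" by simp
    hence "real (k_cov_lin TYPE('a) t n (\<rho> * real n)) / n \<le> (max 0 (a n) + 1 + t * (log 2 (t * n * q) + 1)) / n"
      by (rule divide_right_mono) simp
    also have "\<dots> = max 0 (a n) / n + 1 / n + t * (log 2 (t * n * q) + 1) / n" by (simp add: add_divide_distrib)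
    also have "max 0 (a n) / n = max 0 (1 + Q * ln 2 / ln q / n - E n / (t * ln q))"
    proof -
      have "a n / n = 1 + Q * ln 2 / ln q / n - E n / (t * ln q)"
        unfolding a_def using n by (simp add: diff_divide_distrib add_divide_distrib)
      moreover have "max 0 (a n) / n = max (0 / n) (a n / n)" using n by (auto simp: max_def
          divide_le_eq_1 field_simps)
      ultimately show ?thesis by simp
    qed
    finally show ?thesis unfolding U_def by simp
  qed
  have l1: "(\<lambda>n. Q * ln 2 / ln q / real n) \<longlonglongrightarrow> 0" by real_asymp
  have l2: "(\<lambda>n. 1 / real n) \<longlonglongrightarrow> 0" by real_asymp
  have "real t > 0" "q > 0" using t q2 by simp_all
  hence l3: "(\<lambda>n. t * (log 2 (t * n * q) + 1) / real n) \<longlonglongrightarrow> 0" by real_asymp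
  have lE: "(\<lambda>n. E n / (t * ln q)) \<longlonglongrightarrow> entropy Q x * ln Q / (t * ln q)"
    using t lnq by (intro tendsto_divide lim(3) tendsto_const) auto
  have "U \<longlonglongrightarrow> max 0 (1 + 0 - entropy Q x * ln Q / (t * ln q)) + 0 + 0"
    unfolding U_def by (intro tendsto_add tendsto_max tendsto_diff tendsto_const l1 l2 l3 lE)
  \<comment> \<open>The maximum disappears because the entropy is at most 1, and
    \<open>ln Q = t * ln q\<close> cancels the denominator.\<close>
  also have "max 0 (1 + 0 - entropy Q x * ln Q / (t * ln q)) + 0 + 0 = 1 - entropy Q x"
    using entropy_le_1[OF Q2 x(1) x1] lnq t unfolding lnQ by simp
  finally have "U \<longlonglongrightarrow> 1 - entropy Q x" .
  hence lU: "(\<lambda>n. ereal (U n)) \<longlonglongrightarrow> ereal (1 - entropy Q x)" by simp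
  have "kappa_lin TYPE('a) t \<rho> \<le> liminf (\<lambda>n. ereal (U n))"
    unfolding kappa_lin_def using le by (intro Liminf_mono eventually_sequentiallyI[of 1])
  also have "\<dots> = ereal (1 - entropy Q x)" using lU by (intro lim_imp_Liminf) auto
  finally show ?thesis unfolding Q_def .
qed

theorem theorem2:
  fixes q t :: nat and \<rho> :: real
  assumes "primepow q" and "CARD('a::{field,finite}) = q"
    and "t \<ge> 1" and "0 \<le> \<rho>" and "\<rho> \<le> 1"
  shows "kappa_lin TYPE('a) t \<rho> = kappa TYPE('a) t \<rho> \<and>
         kappa TYPE('a) t \<rho> =
           ereal (if \<rho> < 1 - 1 / real q ^ t then 1 - entropy (q ^ t) \<rho> else 0)"
proof -
  let ?L = "if \<rho> < 1 - 1 / real q ^ t then 1 - entropy (q ^ t) \<rho> else 0"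
  have qt: "real (CARD('a) ^ t) = real q ^ t" using assms(2) by simp
  have q2: "q \<ge> 2" using card_field_ge_2[where 'a = 'a] assms(2) by simp
  have upper: "kappa_lin TYPE('a) t \<rho> \<le> ereal ?L"
  proof (cases "\<rho> < 1 - 1 / real q ^ t")
    case True
    thus ?thesis using kappa_lin_le[OF assms(3), of \<rho> \<rho>, where 'a = 'a] assms(2,4) qt by simp
  next
    case False
    have "q ^ 1 \<le> q ^ t" using assms(3) q2 by (intro power_increasing) auto
    hence Q2: "q ^ t \<ge> 2" using q2 by simp
    have "real 2 \<le> real (q ^ t)" using Q2 by (simp only: of_nat_le_iff)
    hence "1 / real (q ^ t) \<le> 1" using q2 by (subst divide_le_eq_1_pos) auto
    hence "0 \<le> 1 - 1 / real (q ^ t)" by simp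
    \<comment> \<open>Beyond the threshold the smaller relative weight \<open>1 - 1 / Q\<close>
      already gives rate 0, since the entropy equals 1 there.\<close>
    hence "kappa_lin TYPE('a) t \<rho> \<le> ereal (1 - entropy (q ^ t) (1 - 1 / real (q ^ t)))"
      using kappa_lin_le[OF assms(3), of "1 - 1 / real (q ^ t)" \<rho>, where 'a = 'a] assms(2) False by simp
    thus ?thesis using False entropy_max[OF Q2] by simp
  qed
  have middle: "kappa TYPE('a) t \<rho> \<le> kappa_lin TYPE('a) t \<rho>"
    unfolding kappa_def kappa_lin_def
    using assms(4) by (intro Liminf_mono always_eventually allI) (simp add: divide_right_mono
        k_cov_le_k_cov_lin)
  have lower: "ereal ?L \<le> kappa TYPE('a) t \<rho>"
    unfolding kappa_def
  proof (intro Liminf_bounded eventually_sequentiallyI[of 1])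
    fix n :: nat assume n: "1 \<le> n"
    \<comment> \<open>Sphere covering below the threshold; above it the claim is that a nonempty
      code has nonnegative logarithmic size.\<close>
    have "?L * n \<le> k_cov TYPE('a) t n (\<rho> * n)"
    proof (cases "\<rho> < 1 - 1 / real q ^ t")
      case True
      thus ?thesis using k_cov_ge[OF assms(3), of \<rho> n, where 'a = 'a] assms(2,4) qt by (simp add: mult.commute)
    next
      case False
      thus ?thesis using k_cov_nonneg[of "\<rho> * n" t n, where 'a = 'a] assms(4) by simp
    qed
    thus "ereal ?L \<le> ereal (k_cov TYPE('a) t n (\<rho> * n) / n)"
      using n by (simp only: ereal_less_eq pos_le_divide_eq)
  qed
  show ?thesis using upper middle lower by (meson antisym order_trans)
qed

end
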